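(* Let $G$ be a connected ribbon graph and fix any total order $\prec$ on $E(G)$. Then \[ P_{G}(X,Y,A,B) = \sum_{Q \in \mathcal{Q}_{G}} T_{G_{Q}}(X,A)\, T_{G^{*}_{Q^{*}}}(Y,B)\, A^{s(F_{\mathcal{VI}(Q)})/2}\, B^{s(R_{\mathcal{VE}(Q)})/2}. \]
   Context: A ribbon graph is a compact surface with boundary decomposed into vertex discs and edge ribbons. For a ribbon graph $F$: $v(F)$, $e(F)$, $c(F)$, $bc(F)$ are its numbers of vertices, edges, connected components and boundary components, and $s(F) = 2c(F) - v(F) + e(F) - bc(F)$. A spanning subgraph contains all vertex discs and some edges; for $H\subseteq E(G)$, $F_H$ is the spanning subgraph of $G$ with edge set $H$. The dual $G^*$ is obtained by gluing a disc to each boundary component of $G$ (the vertices of $G^*$) and deleting the vertex discs of $G$; edges $e$ of $G$ correspond to edges $e^*$ of $G^*$. For $H \subseteq E(G)$, $R_H$ denotes the spanning subgraph of $G^*$ with edge set $\{e^* : e\in H\}$; for a spanning subgraph $F$ of $G$, $F^* = R_{E(G)\setminus E(F)}$. The generalized Krushkal polynomial of $G$ is \[ P_G(X,Y,A,B) = \sum_{F\subseteq G} X^{c(F)-c(G)}\, Y^{c(F^* )-c(G^* )}\, A^{s(F)/2}\, B^{s(F^* )/2}. \] For an ordinary graph $H$ with nullity $n(H)=e(H)-v(H)+c(H)$, the Tutte polynomial is $T_H(X,Y) = \sum_{F\subseteq H} X^{c(F)-c(H)} Y^{n(F)}$ (sum over spanning subgraphs). The partial dual $G^H$ is obtained by gluing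 a disc to each boundary curve of $F_H$ and removing the interiors of the vertex discs of $G$; its edges correspond to those of $G$. $\mathcal{Q}_G$ is the set of quasi-trees of $G$, i.e. spanning subgraphs $Q$ with $bc(Q) = 1$; then $G^{E(Q)}$ has a single vertex. Edges $e,e'$ link (w.r.t. $Q$) if, traversing the boundary of the vertex of $G^{E(Q)}$, the attaching arcs of $e$ and $e'$ alternate. An edge is live if it links no $\prec$-lower edge, dead otherwise; internal if in $E(Q)$, external otherwise; orientable/nonorientable according as it forms an orientable/nonorientable loop in $G^{E(Q)}$. Let $\mathcal{I}_o(Q)$ (resp. $\mathcal{E}_o(Q)$) be the internally (resp. externally) live orientable edges, $\mathcal{VI}(Q)$ the internal edges that are dead or live nonorientable, and $\mathcal{VE}(Q)$ the external edges that are dead or live nonorientable. $Q^*$ denotes the quasi-tree of $G^*$ with edges $e^*$, $e\notin E(Q)$. $G_Q$ is the ordinary graph whose vertices are the connected components of $F_{\mathcal{VI}(Q)}$ and whose edges are the edges of $\mathcal{I}_o(Q)$, each joining the components containing its endpoints. $G^*_{Q^*}$ is the ordinary graph whose vertices are the connected components of $R_{\mathcal{VE}(Q)}$ and whose edges are the edges $e^*$, $e \in \mathcal{E}_o(Q)$, each joining the components containing its endpoints in $G^*$. *)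

theory Defs
  imports Main
begin

section \<open>Ribbon graphs\<close>

text \<open>
  A ribbon graph is encoded by the cell structure of its surface. The ribbon of an edge \<open>e\<close> is a
  square \<open>[0,1] \<times> [0,1]\<close>. Its corner \<open>(e, i, s)\<close> lies at the end \<open>i\<close> and on the side \<open>s\<close>: the
  ribbon is glued to vertex discs along the two attaching arcs joining \<open>(e, i, False)\<close> to
  \<open>(e, i, True)\<close>, while its two sides joining \<open>(e, False, s)\<close> to \<open>(e, True, s)\<close> remain free.

  Removing the attaching arcs from the boundary circles of the vertex discs that meet a ribbon
  leaves free arcs, each with two distinct corners as its end points; \<open>free_arc\<close> maps a corner to
  the other end of its free arc. These circles, hence the discs, are recovered as the closed curves
  alternating between attaching arcs and free arcs. The vertex discs that meet no ribbon carry no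
  corner, so they are listed separately in \<open>bare_discs\<close>.
\<close>

type_synonym 'e corner = "'e \<times> bool \<times> bool"

record ('e, 'd) ribbon_graph =
  edges :: "'e set"
  bare_discs :: "'d set"
  free_arc :: "'e corner \<Rightarrow> 'e corner"

definition corners :: "('e, 'd) ribbon_graph \<Rightarrow> 'e corner set" where
  "corners G = edges G \<times> UNIV \<times> UNIV"

definition ribbon_graph :: "('e, 'd) ribbon_graph \<Rightarrow> bool" where
  "ribbon_graph G \<longleftrightarrow>
     finite (edges G) \<and> finite (bare_discs G) \<and>
     (\<forall>p\<in>corners G. free_arc G p \<in> corners G \<and> free_arc G p \<noteq> p \<and>
        free_arc G (free_arc G p) = p)"

text \<open>
  Points of the surface: all corners, and one point on the boundary circle of every bare disc.
  Every vertex disc, connected component and boundary component of a spanning subgraph contains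
  such a point and is represented by the set of all the points lying on it.
\<close>

definition points :: "('e, 'd) ribbon_graph \<Rightarrow> ('e corner + 'd) set" where
  "points G = Inl ` corners G \<union> Inr ` bare_discs G"

definition free_arcs :: "('e, 'd) ribbon_graph \<Rightarrow> ('e corner + 'd) rel" where
  "free_arcs G = {(Inl p, Inl (free_arc G p)) | p. p \<in> corners G}"

definition attaching_arcs :: "'e set \<Rightarrow> ('e corner + 'd) rel" where
  "attaching_arcs H = {(Inl (e, i, s), Inl (e, i, \<not> s)) | e i s. e \<in> H}"

definition side_arcs :: "'e set \<Rightarrow> ('e corner + 'd) rel" where
  "side_arcs H = {(Inl (e, i, s), Inl (e, \<not> i, s)) | e i s. e \<in> H}"

definition vertices :: "('e, 'd) ribbon_graph \<Rightarrow> ('e corner + 'd) set set" where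
  "vertices G = points G // (free_arcs G \<union> attaching_arcs (edges G))\<^sup>*"

text \<open>
  The spanning subgraph \<open>F\<^sub>H\<close> is given by its edge set \<open>H \<subseteq> edges G\<close>; it consists of all vertex
  discs of \<open>G\<close> and the ribbons in \<open>H\<close>. So an attaching arc of a ribbon outside \<open>H\<close> still lies on a
  vertex disc of \<open>F\<^sub>H\<close>, and it is a part of the boundary of \<open>F\<^sub>H\<close>.
\<close>

definition components :: "('e, 'd) ribbon_graph \<Rightarrow> 'e set \<Rightarrow> ('e corner + 'd) set set" where
  "components G H =
     points G // (free_arcs G \<union> attaching_arcs (edges G) \<union> side_arcs H)\<^sup>*"

definition boundary_components ::
    "('e, 'd) ribbon_graph \<Rightarrow> 'e set \<Rightarrow> ('e corner + 'd) set set" where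
  "boundary_components G H =
     points G // (free_arcs G \<union> side_arcs H \<union> attaching_arcs (edges G - H))\<^sup>*"

definition num_comp :: "('e, 'd) ribbon_graph \<Rightarrow> 'e set \<Rightarrow> nat" where
  "num_comp G H = card (components G H)"

definition num_bc :: "('e, 'd) ribbon_graph \<Rightarrow> 'e set \<Rightarrow> nat" where
  "num_bc G H = card (boundary_components G H)"

definition s_param :: "('e, 'd) ribbon_graph \<Rightarrow> 'e set \<Rightarrow> int" where
  "s_param G H =
     2 * int (num_comp G H) - int (card (vertices G)) + int (card H) - int (num_bc G H)"

definition connected_ribbon_graph :: "('e, 'd) ribbon_graph \<Rightarrow> bool" where
  "connected_ribbon_graph G \<longleftrightarrow> num_comp G (edges G) = 1"


section \<open>Partial duals\<close>

text \<open>
  The new vertex discs are bounded by the boundary components of \<open>F\<^sub>H\<close>. The free arcs are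
  unchanged, and so is the attachment of the ribbons outside \<open>H\<close>. A ribbon in \<open>H\<close> becomes attached
  along its former sides and has its former attaching arcs as sides, so that its two coordinates
  are exchanged. A bare disc is replaced by another bare disc.
\<close>

definition flip :: "'e set \<Rightarrow> 'e corner \<Rightarrow> 'e corner" where
  "flip H = (\<lambda>(e, i, s). if e \<in> H then (e, s, i) else (e, i, s))"

definition partial_dual :: "('e, 'd) ribbon_graph \<Rightarrow> 'e set \<Rightarrow> ('e, 'd) ribbon_graph" where
  "partial_dual G H = G\<lparr>free_arc := flip H \<circ> free_arc G \<circ> flip H\<rparr>"

text \<open>The edge \<open>e\<^sup>*\<close> of the dual is denoted by \<open>e\<close> again; thus \<open>R\<^sub>H\<close> is given by \<open>dual G\<close> and \<open>H\<close>.\<close>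

definition dual :: "('e, 'd) ribbon_graph \<Rightarrow> ('e, 'd) ribbon_graph" where
  "dual G = partial_dual G (edges G)"

lemma ribbon_graph_partial_dual:
  assumes "ribbon_graph G"
  shows "ribbon_graph (partial_dual G H)"
proof -
  have flip_flip: "flip H (flip H p) = p" for p :: "'a corner"
    by (auto simp: flip_def split: prod.splits)
  have flip_corners: "flip H p \<in> corners G \<longleftrightarrow> p \<in> corners G" for p
    by (auto simp: flip_def corners_def split: prod.splits)
  have eqs: "corners (partial_dual G H) = corners G" "edges (partial_dual G H) = edges G"
    "bare_discs (partial_dual G H) = bare_discs G"
    "free_arc (partial_dual G H) p = flip H (free_arc G (flip H p))" for p
    by (simp_all add: corners_def partial_dual_def)
  have "flip H (free_arc G (flip H p)) \<noteq> p" if "p \<in> corners G" for p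
    using assms that flip_flip flip_corners unfolding ribbon_graph_def by metis
  then show ?thesis
    using assms by (simp add: ribbon_graph_def eqs flip_flip flip_corners)
qed


section \<open>The generalized Krushkal polynomial\<close>

text \<open>
  The exponents \<open>s/2\<close> may be half-integral, so the polynomial is evaluated at square roots
  \<open>a\<close> of \<open>A\<close> and \<open>b\<close> of \<open>B\<close>. The truncations at zero in the exponents below have no
  effect, as the numbers concerned are nonnegative for ribbon graphs and for finite graphs.
\<close>

definition krushkal :: "('e, 'd) ribbon_graph \<Rightarrow> 'k \<Rightarrow> 'k \<Rightarrow> 'k \<Rightarrow> 'k \<Rightarrow> 'k::comm_ring_1" where
  "krushkal G X Y a b =
     (\<Sum>H\<in>Pow (edges G).
        X ^ (num_comp G H - num_comp G (edges G)) *
        Y ^ (num_comp (dual G) (edges G - H) - num_comp (dual G) (edges G)) *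
        a ^ nat (s_param G H) *
        b ^ nat (s_param (dual G) (edges G - H)))"


section \<open>Graphs and the Tutte polynomial\<close>

record ('v, 'e) multigraph =
  mverts :: "'v set"
  medges :: "'e set"
  mends :: "'e \<Rightarrow> 'v set"

definition mcomp :: "('v, 'e) multigraph \<Rightarrow> 'e set \<Rightarrow> nat" where
  "mcomp K F = card (mverts K // {(u, v). \<exists>e\<in>F. u \<in> mends K e \<and> v \<in> mends K e}\<^sup>*)"

definition nullity :: "('v, 'e) multigraph \<Rightarrow> 'e set \<Rightarrow> int" where
  "nullity K F = int (card F) - int (card (mverts K)) + int (mcomp K F)"

definition tutte :: "('v, 'e) multigraph \<Rightarrow> 'k \<Rightarrow> 'k \<Rightarrow> 'k::comm_ring_1" where
  "tutte K X Y =
     (\<Sum>F\<in>Pow (medges K). X ^ (mcomp K F - mcomp K (medges K)) * Y ^ nat (nullity K F))"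


section \<open>Quasi-trees and activities\<close>

definition quasi_trees :: "('e, 'd) ribbon_graph \<Rightarrow> 'e set set" where
  "quasi_trees G = {Q. Q \<subseteq> edges G \<and> num_bc G Q = 1}"

text \<open>
  Traversing the boundary of a vertex disc: from the corner \<open>p\<close> at which an attaching arc is
  entered, cross this arc and follow the next free arc to the corner at which the next attaching
  arc is entered.
\<close>

definition next_arc :: "('e, 'd) ribbon_graph \<Rightarrow> 'e corner \<Rightarrow> 'e corner" where
  "next_arc G = (\<lambda>(e, i, s). free_arc G (e, i, \<not> s))"

text \<open>
  The edges whose attaching arcs are met, in order, when traversing the boundary of the disc of a
  one-vertex ribbon graph once, starting from the corner \<open>p\<close>. There are two attaching arcs for
  each edge.
\<close>

definition boundary_word :: "('e, 'd) ribbon_graph \<Rightarrow> 'e corner \<Rightarrow> 'e list" where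
  "boundary_word G p = map (\<lambda>n. fst ((next_arc G ^^ n) p)) [0..<2 * card (edges G)]"

definition alternate :: "('e, 'd) ribbon_graph \<Rightarrow> 'e \<Rightarrow> 'e \<Rightarrow> bool" where
  "alternate G e f \<longleftrightarrow>
     (\<exists>p\<in>corners G. \<exists>i j k l. i < j \<and> j < k \<and> k < l \<and> l < length (boundary_word G p) \<and>
        boundary_word G p ! i = e \<and> boundary_word G p ! j = f \<and>
        boundary_word G p ! k = e \<and> boundary_word G p ! l = f)"

text \<open>
  The loop \<open>e\<close> is orientable if orientations of the vertex disc and of the ribbon can be chosen to
  agree. The boundary orientation of the square \<open>[0,1] \<times> [0,1]\<close> runs through its two ends in
  opposite directions of the side coordinate, so this means that a traversal of the boundary of the
  disc enters one attaching arc of \<open>e\<close> on side \<open>s\<close> and the other one on side \<open>\<not> s\<close>.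
\<close>

definition orientable_loop :: "('e, 'd) ribbon_graph \<Rightarrow> 'e \<Rightarrow> bool" where
  "orientable_loop G e \<longleftrightarrow> (\<exists>s n. (next_arc G ^^ n) (e, False, s) = (e, True, \<not> s))"

definition links :: "('e, 'd) ribbon_graph \<Rightarrow> 'e set \<Rightarrow> 'e \<Rightarrow> 'e \<Rightarrow> bool" where
  "links G Q e f \<longleftrightarrow> alternate (partial_dual G Q) e f"

definition orientable_edge :: "('e, 'd) ribbon_graph \<Rightarrow> 'e set \<Rightarrow> 'e \<Rightarrow> bool" where
  "orientable_edge G Q e \<longleftrightarrow> orientable_loop (partial_dual G Q) e"

text \<open>The argument \<open>r\<close> is the reflexive form of the total order on the edges.\<close>

definition live :: "('e, 'd) ribbon_graph \<Rightarrow> 'e rel \<Rightarrow> 'e set \<Rightarrow> 'e \<Rightarrow> bool" where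
  "live G r Q e \<longleftrightarrow> \<not> (\<exists>f\<in>edges G. (f, e) \<in> r \<and> f \<noteq> e \<and> links G Q e f)"

definition int_live_orientable :: "('e, 'd) ribbon_graph \<Rightarrow> 'e rel \<Rightarrow> 'e set \<Rightarrow> 'e set" where
  "int_live_orientable G r Q = {e \<in> Q. live G r Q e \<and> orientable_edge G Q e}"

definition ext_live_orientable :: "('e, 'd) ribbon_graph \<Rightarrow> 'e rel \<Rightarrow> 'e set \<Rightarrow> 'e set" where
  "ext_live_orientable G r Q = {e \<in> edges G - Q. live G r Q e \<and> orientable_edge G Q e}"

definition VI :: "('e, 'd) ribbon_graph \<Rightarrow> 'e rel \<Rightarrow> 'e set \<Rightarrow> 'e set" where
  "VI G r Q =
     {e \<in> Q. \<not> live G r Q e \<or> (live G r Q e \<and> \<not> orientable_edge G Q e)}"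

definition VE :: "('e, 'd) ribbon_graph \<Rightarrow> 'e rel \<Rightarrow> 'e set \<Rightarrow> 'e set" where
  "VE G r Q =
     {e \<in> edges G - Q. \<not> live G r Q e \<or> (live G r Q e \<and> \<not> orientable_edge G Q e)}"

definition component_graph ::
    "('e, 'd) ribbon_graph \<Rightarrow> 'e set \<Rightarrow> 'e set \<Rightarrow> (('e corner + 'd) set, 'e) multigraph" where
  "component_graph G H L =
     \<lparr>mverts = components G H,
      medges = L,
      mends = (\<lambda>e. {C \<in> components G H. \<exists>i s. Inl (e, i, s) \<in> C})\<rparr>"

definition quasi_tree_graph ::
    "('e, 'd) ribbon_graph \<Rightarrow> 'e rel \<Rightarrow> 'e set \<Rightarrow> (('e corner + 'd) set, 'e) multigraph" where
  "quasi_tree_graph G r Q = component_graph G (VI G r Q) (int_live_orientable G r Q)"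

definition dual_quasi_tree_graph ::
    "('e, 'd) ribbon_graph \<Rightarrow> 'e rel \<Rightarrow> 'e set \<Rightarrow> (('e corner + 'd) set, 'e) multigraph" where
  "dual_quasi_tree_graph G r Q =
     component_graph (dual G) (VE G r Q) (ext_live_orientable G r Q)"

end

theory Submission
  imports Defs
begin

text \<open>
  Fix a quasi-tree \<open>Q\<close> and consider the one-vertex ribbon graph \<open>G\<^sup>Q\<close>. Toggling a nonorientable edge \<open>e\<close>,
  or an orientable edge \<open>e\<close> together with an edge linked to it, turns \<open>Q\<close> into another quasi-tree; if
  however \<open>e\<close> is orientable and a set \<open>W\<close> containing \<open>e\<close> has no edge linked to \<open>e\<close>, then toggling \<open>W\<close>
  leaves the two sides of the chord \<open>e\<close> on different boundary components. Hence \<open>e\<close> is live and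
  orientable if and only if all quasi-trees that agree with \<open>Q\<close> on the edges above \<open>e\<close> also agree
  with \<open>Q\<close> at \<open>e\<close>. Deciding the edges in decreasing order, following a given \<open>H\<close> unless the decision
  is forced by the existence of a quasi-tree, therefore yields a unique \<open>Q\<close> that differs from \<open>H\<close> only in
  live orientable edges.

  For sets \<open>H\<close> attached to \<open>Q\<close> in this way, toggling \<open>n\<close> live orientable edges of \<open>Q\<close> produces \<open>n + 1\<close>
  boundary components. As an edge joining two components also joins two boundary components, the
  externally live edges do not affect \<open>c(H)\<close>, and the exponents are those of the Tutte polynomial of
  \<open>G\<^sub>Q\<close>. The dual exponents follow because the partial dual of
  \<open>G\<^sup>*\<close> with respect to the complement of \<open>Q\<close> is again \<open>G\<^sup>Q\<close>.
\<close>

section \<open>Counting classes\<close>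

text \<open>Equal fibres: sending a value of \<open>g\<close> to the value of \<open>h\<close> at a
  chosen preimage is a bijection.\<close>

lemma card_image_cong_kernel:
  assumes "\<And>x y. x \<in> P \<Longrightarrow> y \<in> P \<Longrightarrow> g x = g y \<longleftrightarrow> h x = h y"
  shows "card (g ` P) = card (h ` P)"
proof -
  have "bij_betw (\<lambda>c. h (SOME x. x \<in> P \<and> g x = c)) (g ` P) (h ` P)"
  proof -
    have some: "(SOME x. x \<in> P \<and> g x = g y) \<in> P \<and> g (SOME x. x \<in> P \<and> g x = g y) = g y"
      if "y \<in> P" for y
      using that by (intro someI_ex[where P = "\<lambda>x. x \<in> P \<and> g x = g y"]) auto
    then have h: "h (SOME x. x \<in> P \<and> g x = g y) = h y" if "y \<in> P" for y
      using that assms by blast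
    show ?thesis
      unfolding bij_betw_def inj_on_def
      by (auto simp: h assms image_image cong: image_cong)
  qed
  then show ?thesis by (rule bij_betw_same_card)
qed

lemma quotient_image: "P // r = (\<lambda>x. r `` {x}) ` P"
  by (auto simp: quotient_def)

lemma sym_rtrancl_class_eq_iff:
  assumes "sym r"
  shows "r\<^sup>* `` {x} = r\<^sup>* `` {y} \<longleftrightarrow> (x, y) \<in> r\<^sup>*"
proof
  assume "r\<^sup>* `` {x} = r\<^sup>* `` {y}"
  then show "(x, y) \<in> r\<^sup>*" by auto
next
  assume xy: "(x, y) \<in> r\<^sup>*"
  then have "(y, x) \<in> r\<^sup>*" using sym_rtrancl[OF assms] by (auto dest: symD)
  then show "r\<^sup>* `` {x} = r\<^sup>* `` {y}" using xy by (auto intro: rtrancl_trans)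
qed

text \<open>\<open>f\<close> need not be injective, so this covers both the renaming of corners in a
  partial dual and the collapse of points to components.\<close>

lemma card_quotient_transfer:
  assumes "sym r" "sym r'" "f ` P = P'"
    and "\<And>x y. x \<in> P \<Longrightarrow> y \<in> P \<Longrightarrow> (x, y) \<in> r\<^sup>* \<longleftrightarrow> (f x, f y) \<in> r'\<^sup>*"
  shows "card (P // r\<^sup>*) = card (P' // r'\<^sup>*)"
proof -
  have "card ((\<lambda>x. r\<^sup>* `` {x}) ` P) = card ((\<lambda>x. r'\<^sup>* `` {f x}) ` P)"
    by (rule card_image_cong_kernel) (simp add: sym_rtrancl_class_eq_iff assms)
  also have "(\<lambda>x. r'\<^sup>* `` {f x}) ` P = P' // r'\<^sup>*"
    unfolding quotient_image assms(3)[symmetric] by (simp add: image_image)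
  finally show ?thesis by (simp add: quotient_image)
qed

lemma card_quotient_antimono:
  assumes "sym r" "sym r'" "finite P" "r \<subseteq> r'\<^sup>*"
  shows "card (P // r'\<^sup>*) \<le> card (P // r\<^sup>*)"
proof -
  have sub: "r\<^sup>* \<subseteq> r'\<^sup>*" using rtrancl_mono[OF assms(4)] by simp
  have "(\<lambda>C. r'\<^sup>* `` C) (r\<^sup>* `` {x}) = r'\<^sup>* `` {x}" for x
    using sub by (auto intro: rtrancl_trans)
  then have "P // r'\<^sup>* = (\<lambda>C. r'\<^sup>* `` C) ` (P // r\<^sup>*)"
    unfolding quotient_image by (simp add: image_image)
  moreover have "finite (P // r\<^sup>*)" using assms(3) by (simp add: quotient_image)
  ultimately show ?thesis by (simp add: card_image_le)
qed

lemma card_quotient_eq_1_iff: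
  assumes "sym r"
  shows "card (P // r\<^sup>*) = 1 \<longleftrightarrow> P \<noteq> {} \<and> (\<forall>x\<in>P. \<forall>y\<in>P. (x, y) \<in> r\<^sup>*)"
    (is "?L \<longleftrightarrow> ?R")
proof
  assume ?L
  then obtain C where C: "P // r\<^sup>* = {C}" by (auto simp: card_1_singleton_iff)
  have "r\<^sup>* `` {x} = C" if "x \<in> P" for x
    using quotientI[OF that, of "r\<^sup>*"] C by simp
  then have "(x, y) \<in> r\<^sup>*" if "x \<in> P" "y \<in> P" for x y
    using that sym_rtrancl_class_eq_iff[OF assms, of x y] by simp
  moreover have "P \<noteq> {}" using C by (auto simp: quotient_image)
  ultimately show ?R by simp
next
  assume R: ?R
  then obtain x where x: "x \<in> P" by blast
  have "r\<^sup>* `` {y} = r\<^sup>* `` {x}" if "y \<in> P" for y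
    unfolding sym_rtrancl_class_eq_iff[OF assms] using R x that by simp
  then have "P // r\<^sup>* = (\<lambda>_. r\<^sup>* `` {x}) ` P"
    unfolding quotient_image by (rule image_cong[OF refl])
  also have "\<dots> = {r\<^sup>* `` {x}}" using x by (rule image_constant)
  finally show ?L by simp
qed

text \<open>A path through the new pair starts and ends with old steps that lead to \<open>x\<close>
  or \<open>y\<close>. If both ends reach the same point, the first disjunct holds anyway.\<close>

lemma rtrancl_insert_pair_iff:
  assumes "sym r"
  shows "(u, v) \<in> (r \<union> {(x, y), (y, x)})\<^sup>* \<longleftrightarrow>
    (u, v) \<in> r\<^sup>* \<or> ((u, x) \<in> r\<^sup>* \<or> (u, y) \<in> r\<^sup>*) \<and> ((v, x) \<in> r\<^sup>* \<or> (v, y) \<in> r\<^sup>*)"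
    (is "_ \<longleftrightarrow> ?P v")
proof
  have s: "(b, a) \<in> r\<^sup>*" if "(a, b) \<in> r\<^sup>*" for a b
    using that sym_rtrancl[OF assms] by (auto dest: symD)
  show "?P v" if "(u, v) \<in> (r \<union> {(x, y), (y, x)})\<^sup>*"
    using that
  proof induction
    case (step v w)
    from step(2) consider "(v, w) \<in> r" | "v = x" "w = y" | "v = y" "w = x" by auto
    then show ?case
    proof cases
      case 1
      then have "(v, w) \<in> r\<^sup>*" "(w, v) \<in> r\<^sup>*" by (auto intro: s)
      then show ?thesis using step(3) by (meson rtrancl_trans)
    qed (use step(3) s in auto)
  qed auto
  let ?r = "(r \<union> {(x, y), (y, x)})\<^sup>*"
  have sub: "(a, b) \<in> ?r" "(b, a) \<in> ?r" if "(a, b) \<in> r\<^sup>*" for a b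
    using that s[OF that] rtrancl_mono[of r "r \<union> {(x, y), (y, x)}"] by auto
  have "(x, y) \<in> ?r" "(y, x) \<in> ?r" by auto
  then show "(u, v) \<in> ?r" if "?P v"
    using that sub by (meson rtrancl_trans)
qed

lemma card_quotient_merge:
  assumes "sym r" "finite P" "x \<in> P" "y \<in> P" "(x, y) \<notin> r\<^sup>*"
  shows "card (P // (r \<union> {(x, y), (y, x)})\<^sup>*) + 1 = card (P // r\<^sup>*)"
proof -
  let ?r = "r \<union> {(x, y), (y, x)}"
  let ?P = "{z \<in> P. (z, y) \<notin> r\<^sup>*}"
  have sr: "sym ?r" using assms(1) by (auto simp: sym_def)
  have s: "(b, a) \<in> r\<^sup>*" if "(a, b) \<in> r\<^sup>*" for a b
    using that sym_rtrancl[OF assms(1)] by (auto dest: symD)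
  \<comment> \<open>The old class of \<open>y\<close> is absorbed by that of \<open>x\<close>, so
    dropping its points loses no new class; on the remaining points both relations agree.\<close>
  have "P // ?r\<^sup>* = ?P // ?r\<^sup>*"
  proof -
    have "?r\<^sup>* `` {z} = ?r\<^sup>* `` {x}" if "(z, y) \<in> r\<^sup>*" for z
      using that unfolding sym_rtrancl_class_eq_iff[OF sr] rtrancl_insert_pair_iff[OF assms(1)] by blast
    moreover have "x \<in> ?P" using assms by auto
    ultimately show ?thesis unfolding quotient_image by (auto simp: image_iff)
  qed
  moreover have "card (?P // ?r\<^sup>*) = card (?P // r\<^sup>*)"
  proof (rule card_quotient_transfer[where f = id])
    show "(u, v) \<in> ?r\<^sup>* \<longleftrightarrow> (id u, id v) \<in> r\<^sup>*" if "u \<in> ?P" "v \<in> ?P" for u v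
    proof -
      have "(u, v) \<in> r\<^sup>*" if "(u, x) \<in> r\<^sup>*" "(v, x) \<in> r\<^sup>*"
        using that s by (meson rtrancl_trans)
      then show ?thesis
        using that unfolding rtrancl_insert_pair_iff[OF assms(1)] by auto
    qed
  qed (use sr assms(1) in auto)
  moreover have "P // r\<^sup>* = insert (r\<^sup>* `` {y}) (?P // r\<^sup>*)"
  proof -
    have "r\<^sup>* `` {z} = r\<^sup>* `` {y}" if "(z, y) \<in> r\<^sup>*" for z
      using that unfolding sym_rtrancl_class_eq_iff[OF assms(1)] .
    then show ?thesis using assms(4) unfolding quotient_image by blast
  qed
  moreover have "r\<^sup>* `` {y} \<notin> ?P // r\<^sup>*"
    unfolding quotient_image using sym_rtrancl_class_eq_iff[OF assms(1)] s by blast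
  moreover have "finite (?P // r\<^sup>*)" using assms(2) by (simp add: quotient_image)
  ultimately show ?thesis by simp
qed

lemma even_card_fixpoint_free_involution:
  assumes "finite C" "\<And>x. x \<in> C \<Longrightarrow> f x \<in> C" "\<And>x. x \<in> C \<Longrightarrow> f (f x) = x"
    "\<And>x. x \<in> C \<Longrightarrow> f x \<noteq> x"
  shows "even (card C)"
  using assms
proof (induction "card C" arbitrary: C rule: less_induct)
  case less
  show ?case
  proof (cases "C = {}")
    case False
    then obtain x where x: "x \<in> C" by auto
    let ?D = "C - {x, f x}"
    have sub: "{x, f x} \<subseteq> C" using less.prems x by auto
    have c2: "card {x, f x} = 2" using less.prems(4)[OF x] by auto
    have card: "card C = card ?D + 2"
      using sub less.prems(1) c2 by (metis card_Diff_subset card_mono finite_subset le_add_diff_inverse2)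
    have "f z \<in> ?D" if "z \<in> ?D" for z
      using that less.prems(2,3) x by (metis Diff_iff insert_iff singletonD)
    then have "even (card ?D)"
      using less card by (intro less.hyps) auto
    then show ?thesis using card by simp
  qed simp
qed

section \<open>Boundary components\<close>

text \<open>
  The boundary of \<open>F\<^sub>T\<close> alternates between free arcs and the arcs joining \<open>c\<close> to \<open>ribbon_arc T c\<close>.
  Toggling \<open>e\<close> in \<open>T\<close> replaces one pairing of the four corners of \<open>e\<close> by another one; the diagonal
  corners \<open>(e, False, False)\<close> and \<open>(e, True, True)\<close> are paired in neither.
\<close>

definition ribbon_arc :: "'e set \<Rightarrow> 'e corner \<Rightarrow> 'e corner" where
  "ribbon_arc T = (\<lambda>(e, i, s). if e \<in> T then (e, \<not> i, s) else (e, i, \<not> s))"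

definition boundary_arcs :: "('e, 'd) ribbon_graph \<Rightarrow> 'e set \<Rightarrow> ('e corner + 'd) rel" where
  "boundary_arcs G T = free_arcs G \<union> {(Inl c, Inl (ribbon_arc T c)) | c. c \<in> corners G}"

definition component_arcs :: "('e, 'd) ribbon_graph \<Rightarrow> 'e set \<Rightarrow> ('e corner + 'd) rel" where
  "component_arcs G H = free_arcs G \<union> attaching_arcs (edges G) \<union> side_arcs H"

definition toggle :: "'e set \<Rightarrow> 'e \<Rightarrow> 'e set" where
  "toggle T e = (if e \<in> T then T - {e} else insert e T)"

lemma toggle_toggle [simp]: "toggle (toggle T e) e = T"
  by (auto simp: toggle_def)

lemma toggle_subset: "T \<subseteq> E \<Longrightarrow> e \<in> E \<Longrightarrow> toggle T e \<subseteq> E"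
  by (auto simp: toggle_def)

lemma corners_iff [simp]: "(e, i, s) \<in> corners G \<longleftrightarrow> e \<in> edges G"
  by (simp add: corners_def)

lemma Inl_mem_points [simp]: "Inl c \<in> points G \<longleftrightarrow> c \<in> corners G"
  by (auto simp: points_def)

lemma ribbon_arc_involution [simp]: "ribbon_arc T (ribbon_arc T c) = c"
  by (auto simp: ribbon_arc_def split: prod.splits)

lemma ribbon_arc_neq [simp]: "ribbon_arc T c \<noteq> c"
  by (auto simp: ribbon_arc_def split: prod.splits)

lemma ribbon_arc_corners [simp]: "ribbon_arc T c \<in> corners G \<longleftrightarrow> c \<in> corners G"
  by (cases c) (auto simp: ribbon_arc_def)

lemma fst_ribbon_arc [simp]: "fst (ribbon_arc T c) = fst c"
  by (auto simp: ribbon_arc_def split: prod.splits)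

text \<open>Every corner meets exactly one of these arcs, so they form one matching. The boundary
  thus consists of curves alternating between two matchings.\<close>

lemma boundary_components_eq:
  fixes G :: "('e, 'd) ribbon_graph"
  assumes "T \<subseteq> edges G"
  shows "boundary_components G T = points G // (boundary_arcs G T)\<^sup>*"
proof -
  have "side_arcs T \<union> attaching_arcs (edges G - T) =
    {(Inl c :: 'e corner + 'd, Inl (ribbon_arc T c)) | c. c \<in> corners G}"
  proof (intro set_eqI iffI)
    fix z :: "('e corner + 'd) \<times> ('e corner + 'd)"
    assume "z \<in> side_arcs T \<union> attaching_arcs (edges G - T)"
    then consider e i s where "z = (Inl (e, i, s), Inl (e, \<not> i, s))" "e \<in> T"
      | e i s where "z = (Inl (e, i, s), Inl (e, i, \<not> s))" "e \<in> edges G - T"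
      unfolding side_arcs_def attaching_arcs_def by blast
    then have "\<exists>c. z = (Inl c, Inl (ribbon_arc T c)) \<and> c \<in> corners G"
      by cases (use assms in \<open>auto simp: ribbon_arc_def\<close>)
    then show "z \<in> {(Inl c, Inl (ribbon_arc T c)) | c. c \<in> corners G}" by blast
  next
    fix z :: "('e corner + 'd) \<times> ('e corner + 'd)"
    assume "z \<in> {(Inl c, Inl (ribbon_arc T c)) | c. c \<in> corners G}"
    then obtain e i s where "z = (Inl (e, i, s), Inl (ribbon_arc T (e, i, s)))" "e \<in> edges G"
      by (auto simp: corners_def)
    then show "z \<in> side_arcs T \<union> attaching_arcs (edges G - T)"
      by (cases "e \<in> T") (auto simp: side_arcs_def attaching_arcs_def ribbon_arc_def)
  qed
  then show ?thesis by (simp add: boundary_components_def boundary_arcs_def Un_assoc)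
qed

lemma num_bc_eq: "T \<subseteq> edges G \<Longrightarrow> num_bc G T = card (points G // (boundary_arcs G T)\<^sup>*)"
  by (simp add: num_bc_def boundary_components_eq)

lemma num_comp_eq: "num_comp G T = card (points G // (component_arcs G T)\<^sup>*)"
  by (simp add: num_comp_def components_def component_arcs_def)

lemma sym_free_arcs:
  assumes "ribbon_graph G"
  shows "sym (free_arcs G)"
proof (rule symI)
  fix x y assume "(x, y) \<in> free_arcs G"
  then obtain p where p: "x = Inl p" "y = Inl (free_arc G p)" "p \<in> corners G"
    unfolding free_arcs_def by blast
  then have "free_arc G p \<in> corners G" "free_arc G (free_arc G p) = p"
    using assms unfolding ribbon_graph_def by blast+
  then have "(Inl (free_arc G p), Inl (free_arc G (free_arc G p))) \<in> free_arcs G"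
    unfolding free_arcs_def by blast
  then show "(y, x) \<in> free_arcs G"
    using p \<open>free_arc G (free_arc G p) = p\<close> by simp
qed

lemma sym_boundary_arcs:
  assumes "ribbon_graph G"
  shows "sym (boundary_arcs G T)"
proof -
  have "sym {(Inl c, Inl (ribbon_arc T c)) | c. c \<in> corners G}"
  proof (rule symI)
    fix x y assume "(x, y) \<in> {(Inl c, Inl (ribbon_arc T c)) | c. c \<in> corners G}"
    then obtain c where "x = Inl c" "y = Inl (ribbon_arc T c)" "c \<in> corners G" by blast
    then have "(y, x) = (Inl (ribbon_arc T c), Inl (ribbon_arc T (ribbon_arc T c)))"
      "ribbon_arc T c \<in> corners G" by simp_all
    then show "(y, x) \<in> {(Inl c, Inl (ribbon_arc T c)) | c. c \<in> corners G}" by blast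
  qed
  then show ?thesis
    unfolding boundary_arcs_def by (intro sym_Un sym_free_arcs[OF assms])
qed

lemma sym_component_arcs:
  assumes "ribbon_graph G"
  shows "sym (component_arcs G T)"
proof -
  have "sym (attaching_arcs S)" "sym (side_arcs S)" for S :: "'a set"
    unfolding sym_def attaching_arcs_def side_arcs_def by auto
  then show ?thesis
    unfolding component_arcs_def by (intro sym_Un sym_free_arcs[OF assms])
qed

lemma finite_corners: "ribbon_graph G \<Longrightarrow> finite (corners G)"
  by (simp add: ribbon_graph_def corners_def)

lemma finite_points: "ribbon_graph G \<Longrightarrow> finite (points G)"
  by (simp add: ribbon_graph_def corners_def points_def)

lemma finite_edges: "ribbon_graph G \<Longrightarrow> finite (edges G)"
  by (simp add: ribbon_graph_def)

lemma free_arcI: "c \<in> corners G \<Longrightarrow> (Inl c, Inl (free_arc G c)) \<in> boundary_arcs G T"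
  unfolding boundary_arcs_def free_arcs_def by blast

lemma ribbon_arcI: "c \<in> corners G \<Longrightarrow> (Inl c, Inl (ribbon_arc T c)) \<in> boundary_arcs G T"
  unfolding boundary_arcs_def by blast

text \<open>
  A path of arcs avoiding \<open>e\<close>, started at a corner of \<open>e\<close>, ends at another corner of \<open>e\<close>: otherwise the
  free arcs would pair off an even and the ribbon arcs an odd number of corners.
\<close>

lemma ribbon_arc_ends_connected_outside:
  assumes G: "ribbon_graph G" and e: "e \<in> edges G" and p: "fst p = e"
    and only: "\<And>c. (Inl p, Inl c) \<in> (boundary_arcs G T)\<^sup>* \<Longrightarrow> fst c = e \<Longrightarrow> c = p \<or> c = ribbon_arc T p"
  defines "R \<equiv> free_arcs G \<union> {(Inl c :: _ + 'd, Inl (ribbon_arc T c)) | c. c \<in> corners G \<and> fst c \<noteq> e}"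
  shows "(Inl p, Inl (ribbon_arc T p)) \<in> R\<^sup>*"
proof (rule ccontr)
  assume not: "(Inl p, Inl (ribbon_arc T p)) \<notin> R\<^sup>*"
  define C where "C = {c. (Inl p, Inl c :: _ + 'd) \<in> R\<^sup>*}"
  have pc: "p \<in> corners G" using e p by (cases p) auto
  have sub: "R\<^sup>* \<subseteq> (boundary_arcs G T)\<^sup>*"
    by (rule rtrancl_mono) (auto simp: R_def boundary_arcs_def)
  have rng: "\<exists>c\<in>corners G. z = Inl c" if "(Inl p, z) \<in> R\<^sup>*" for z
    using that
    by induction (use pc G in \<open>auto simp: R_def free_arcs_def ribbon_graph_def\<close>)
  have CG: "C \<subseteq> corners G" using rng by (fastforce simp: C_def)
  have fin: "finite C" using CG finite_corners[OF G] by (rule finite_subset)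
  have pC: "p \<in> C" by (simp add: C_def)
  have onlyp: "c = p" if "c \<in> C" "fst c = e" for c
    using only[of c] that not sub by (auto simp: C_def)
  have "even (card C)"
  proof (rule even_card_fixpoint_free_involution[OF fin])
    fix c assume c: "c \<in> C"
    then have cc: "c \<in> corners G" using CG by auto
    then have "(Inl c, Inl (free_arc G c)) \<in> R" unfolding R_def free_arcs_def by blast
    then show "free_arc G c \<in> C"
      using c by (auto simp: C_def intro: rtrancl_into_rtrancl)
    show "free_arc G (free_arc G c) = c" "free_arc G c \<noteq> c"
      using G cc by (auto simp: ribbon_graph_def)
  qed
  moreover have "even (card (C - {p}))"
  proof (rule even_card_fixpoint_free_involution)
    fix c assume c: "c \<in> C - {p}"
    then have ce: "fst c \<noteq> e" using onlyp by blast
    have "(Inl c, Inl (ribbon_arc T c)) \<in> R" using c CG ce unfolding R_def by blast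
    then have "ribbon_arc T c \<in> C"
      using c by (auto simp: C_def intro: rtrancl_into_rtrancl)
    moreover have "ribbon_arc T c \<noteq> p" using ce p by auto
    ultimately show "ribbon_arc T c \<in> C - {p}" by simp
  qed (use fin in simp_all)
  moreover have "card C = Suc (card (C - {p}))" using card.remove[OF fin pC] .
  ultimately show False by simp
qed

text \<open>Whether or not \<open>e\<close> lies in \<open>T\<close>, each diagonal corner is paired
  with one of the other two corners, so connecting the diagonal ties all four together.\<close>

lemma ribbon_corners_connected:
  fixes r :: "('e corner + 'd) rel"
  assumes r: "sym r" and d: "(Inl (e, False, False), Inl (e, True, True)) \<in> r\<^sup>*"
    and arcs: "(Inl (e, False, False), Inl (ribbon_arc T (e, False, False))) \<in> r\<^sup>*"
      "(Inl (e, True, True), Inl (ribbon_arc T (e, True, True))) \<in> r\<^sup>*"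
    and c: "fst c = e" "fst c' = e"
  shows "(Inl c, Inl c') \<in> r\<^sup>*"
proof -
  have "(Inl (e, True, True), Inl (e, False, False)) \<in> r\<^sup>*"
    using d sym_rtrancl[OF r] by (rule symD[rotated])
  then have *: "(Inl (e, False, False), Inl b) \<in> r\<^sup>*" if b: "fst b = e" for b
  proof -
    obtain i j where "b = (e, i, j)" using b by (cases b) auto
    then show ?thesis
      using d arcs rtrancl_trans[OF d arcs(2)]
      by (cases i; cases j) (auto simp: ribbon_arc_def split: if_splits)
  qed
  show ?thesis
    using rtrancl_trans[OF symD[OF sym_rtrancl[OF r] *[OF c(1)]] *[OF c(2)]] .
qed

text \<open>Two different boundary curves pass along the ribbon \<open>e\<close>. Toggling cuts its
  two arcs and reconnects the four ends, which fuses the curves into one.\<close>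

lemma num_bc_toggle_separated:
  assumes G: "ribbon_graph G" and T: "T \<subseteq> edges G" and e: "e \<in> edges G"
    and sep: "(Inl (e, False, False), Inl (e, True, True)) \<notin> (boundary_arcs G T)\<^sup>*"
  shows "num_bc G (toggle T e) + 1 = num_bc G T"
proof -
  let ?B = "boundary_arcs G T" and ?B' = "boundary_arcs G (toggle T e)"
  define p where "p = (e, False, False)"
  define s where "s = (e, True, True)"
  have fst: "fst p = e" "fst s = e" by (simp_all add: p_def s_def)
  have corn: "p \<in> corners G" "s \<in> corners G" using e by (auto simp: p_def s_def)
  have cases: "c = p \<or> c = s \<or> c = ribbon_arc T p \<or> c = ribbon_arc T s" if "fst c = e" for c
    using that by (cases c) (auto simp: p_def s_def ribbon_arc_def)
  have toggled: "ribbon_arc (toggle T e) p = ribbon_arc T s" "ribbon_arc (toggle T e) s = ribbon_arc T p"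
    by (auto simp: p_def s_def ribbon_arc_def toggle_def)
  have same: "ribbon_arc (toggle T e) c = ribbon_arc T c" if "fst c \<noteq> e" for c
    using that by (auto simp: ribbon_arc_def toggle_def split: prod.splits)
  note syms = sym_rtrancl[OF sym_boundary_arcs[OF G]]
  have pp: "(Inl p, Inl (ribbon_arc T p)) \<in> ?B\<^sup>*" and ss: "(Inl s, Inl (ribbon_arc T s)) \<in> ?B\<^sup>*"
    using corn by (auto intro: ribbon_arcI)
  have sep: "(Inl p, Inl s) \<notin> ?B\<^sup>*" using sep by (simp add: p_def s_def)
  have sep': "(Inl s, Inl p) \<notin> ?B\<^sup>*" using sep syms by (auto dest: symD)
  have sep_arc: "(Inl p, Inl (ribbon_arc T s)) \<notin> ?B\<^sup>*" "(Inl s, Inl (ribbon_arc T p)) \<notin> ?B\<^sup>*"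
    using sep sep' pp ss syms by (meson rtrancl_trans symD)+
  \<comment> \<open>\<open>?R\<close> contains the arcs common to both edge sets; along them
    \<open>p\<close> and \<open>s\<close> reach their former partners the long way round.\<close>
  let ?R = "free_arcs G \<union> {(Inl c, Inl (ribbon_arc T c)) | c. c \<in> corners G \<and> fst c \<noteq> e}"
  have "?R \<subseteq> ?B'" using same by (auto simp: boundary_arcs_def)
  then have RB: "?R\<^sup>* \<subseteq> ?B'\<^sup>*" by (rule rtrancl_mono)
  have "(Inl p, Inl (ribbon_arc T p)) \<in> ?R\<^sup>*"
    by (rule ribbon_arc_ends_connected_outside[OF G e]) (use fst cases sep sep_arc in blast)+
  then have p': "(Inl p, Inl (ribbon_arc T p)) \<in> ?B'\<^sup>*" using RB by auto
  have "(Inl s, Inl (ribbon_arc T s)) \<in> ?R\<^sup>*"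
    by (rule ribbon_arc_ends_connected_outside[OF G e]) (use fst cases sep' sep_arc in blast)+
  then have s': "(Inl s, Inl (ribbon_arc T s)) \<in> ?B'\<^sup>*" using RB by auto
  have ps': "(Inl p, Inl (ribbon_arc T s)) \<in> ?B'" "(Inl s, Inl (ribbon_arc T p)) \<in> ?B'"
    using ribbon_arcI[OF corn(1)] ribbon_arcI[OF corn(2)] toggled by metis+
  \<comment> \<open>The toggled relation has the same closure as the old one with \<open>p\<close>
    and \<open>s\<close> identified, which merges exactly two classes.\<close>
  let ?M = "?B \<union> {(Inl p, Inl s), (Inl s, Inl p)}"
  have symM: "sym ?M" using sym_boundary_arcs[OF G, of T] by (auto simp: sym_def)
  have BM: "?B\<^sup>* \<subseteq> ?M\<^sup>*" by (rule rtrancl_mono) auto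
  have "?B' \<subseteq> ?M\<^sup>*"
  proof
    fix z assume z: "z \<in> ?B'"
    show "z \<in> ?M\<^sup>*"
    proof (cases "z \<in> ?R")
      case True
      then show ?thesis by (auto simp: boundary_arcs_def)
    next
      case False
      then obtain c where c: "z = (Inl c, Inl (ribbon_arc (toggle T e) c))" "c \<in> corners G"
        using z unfolding boundary_arcs_def by blast
      have "fst c = e"
      proof (rule ccontr)
        assume ne: "fst c \<noteq> e"
        then have "z = (Inl c, Inl (ribbon_arc T c))" using c same by simp
        then show False using False c ne by blast
      qed
      have "(Inl p, Inl s) \<in> ?M\<^sup>*" by auto
      then have "(Inl c, Inl (ribbon_arc (toggle T e) c)) \<in> ?M\<^sup>*"
        apply -
        apply (rule ribbon_corners_connected[OF symM, where T = T])
        using pp ss BM \<open>fst c = e\<close> by (auto simp: p_def s_def)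
      then show ?thesis using c by simp
    qed
  qed
  moreover have "?M \<subseteq> ?B'\<^sup>*"
  proof -
    have sp: "(Inl s, Inl p) \<in> ?B'\<^sup>*" "(Inl p, Inl s) \<in> ?B'\<^sup>*"
    proof -
      show "(Inl s, Inl p) \<in> ?B'\<^sup>*"
        using r_into_rtrancl[OF ps'(2)] symD[OF syms p'] by (rule rtrancl_trans)
      then show "(Inl p, Inl s) \<in> ?B'\<^sup>*" by (rule symD[OF syms])
    qed
    have e2: "(Inl c, Inl d) \<in> ?B'\<^sup>*" if "fst c = e" "fst d = e" for c d
      by (rule ribbon_corners_connected[OF sym_boundary_arcs[OF G], where T = T])
         (use p' s' sp that in \<open>auto simp: p_def s_def\<close>)
    have "?B \<subseteq> ?B'\<^sup>*"
    proof
      fix z assume z: "z \<in> ?B"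
      show "z \<in> ?B'\<^sup>*"
      proof (cases "z \<in> ?R")
        case False
        then obtain c where "z = (Inl c, Inl (ribbon_arc T c))" "fst c = e"
          using z unfolding boundary_arcs_def by blast
        then show ?thesis using e2 by simp
      next
        case True
        then show ?thesis using RB r_into_rtrancl by blast
      qed
    qed
    then show ?thesis using sp by auto
  qed
  ultimately have "?B'\<^sup>* = ?M\<^sup>*"
    by (metis rtrancl_subset_rtrancl subset_antisym)
  then have "num_bc G (toggle T e) = card (points G // ?M\<^sup>*)"
    using toggle_subset[OF T e] by (simp add: num_bc_eq)
  then show ?thesis
    using card_quotient_merge[OF sym_boundary_arcs[OF G] finite_points[OF G] _ _ sep] corn T
    by (simp add: num_bc_eq)
qed

text \<open>All four corners of \<open>e\<close> share one class, so the new arcs stay inside it and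
  the new partition refines the old one.\<close>

lemma num_bc_toggle_not_separated:
  assumes G: "ribbon_graph G" and T: "T \<subseteq> edges G" and e: "e \<in> edges G"
    and conn: "(Inl (e, False, False), Inl (e, True, True)) \<in> (boundary_arcs G T)\<^sup>*"
  shows "num_bc G T \<le> num_bc G (toggle T e)"
proof -
  let ?B = "boundary_arcs G T"
  have e2: "(Inl c, Inl d) \<in> ?B\<^sup>*" if "fst c = e" "fst d = e" for c d
    by (rule ribbon_corners_connected[OF sym_boundary_arcs[OF G] conn, where T = T])
       (use e that in \<open>simp_all add: ribbon_arcI r_into_rtrancl\<close>)
  have "boundary_arcs G (toggle T e) \<subseteq> ?B\<^sup>*"
  proof
    fix z assume z: "z \<in> boundary_arcs G (toggle T e)"
    show "z \<in> ?B\<^sup>*"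
    proof (cases "z \<in> free_arcs G")
      case False
      then obtain c where c: "z = (Inl c, Inl (ribbon_arc (toggle T e) c))" "c \<in> corners G"
        using z unfolding boundary_arcs_def by blast
      show ?thesis
      proof (cases "fst c = e")
        case True
        then show ?thesis using e2 c by simp
      next
        case False
        then have "ribbon_arc (toggle T e) c = ribbon_arc T c"
          by (auto simp: ribbon_arc_def toggle_def split: prod.splits)
        then show ?thesis using c r_into_rtrancl[OF ribbon_arcI[OF c(2), of T]] by simp
      qed
    qed (auto simp: boundary_arcs_def)
  qed
  then show ?thesis
    using card_quotient_antimono[OF sym_boundary_arcs[OF G] sym_boundary_arcs[OF G] finite_points[OF G]]
      T toggle_subset[OF T e] by (simp add: num_bc_eq)
qed

text \<open>Toggling back from \<open>toggle T e\<close> either does not lower the count or lowers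
  it by exactly one.\<close>

lemma num_bc_toggle_le:
  assumes "ribbon_graph G" "T \<subseteq> edges G" "e \<in> edges G"
  shows "num_bc G (toggle T e) \<le> num_bc G T + 1"
proof (cases "(Inl (e, False, False), Inl (e, True, True)) \<in> (boundary_arcs G (toggle T e))\<^sup>*")
  case True
  then show ?thesis
    using num_bc_toggle_not_separated[OF assms(1) toggle_subset[OF assms(2,3)] assms(3)] by simp
next
  case False
  then show ?thesis
    using num_bc_toggle_separated[OF assms(1) toggle_subset[OF assms(2,3)] assms(3)] by simp
qed

section \<open>Connected components\<close>

text \<open>The attaching arcs already join the two corners at each end, so a single connection
  between the ends replaces both sides.\<close>

lemma component_arcs_insert:
  assumes G: "ribbon_graph G" and e: "e \<in> edges G"
  shows "(component_arcs G (insert e H))\<^sup>* =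
    (component_arcs G H \<union> {(Inl (e, False, False), Inl (e, True, False)),
      (Inl (e, True, False), Inl (e, False, False))})\<^sup>*" (is "_ = ?M\<^sup>*")
proof -
  have "side_arcs {e} \<subseteq> ?M\<^sup>*"
  proof
    fix z :: "('a corner + 'b) \<times> ('a corner + 'b)" assume "z \<in> side_arcs {e}"
    then obtain i s where z: "z = (Inl (e, i, s), Inl (e, \<not> i, s))"
      unfolding side_arcs_def by blast
    have att: "(Inl (e, j, t), Inl (e, j, \<not> t)) \<in> ?M\<^sup>*" for j t
      using e by (intro r_into_rtrancl) (auto simp: component_arcs_def attaching_arcs_def)
    have att': "(Inl (e, j, t), Inl (e, j, False)) \<in> ?M\<^sup>*" "(Inl (e, j, False), Inl (e, j, t)) \<in> ?M\<^sup>*" for j t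
      using att[of j t] att[of j False] by (cases t; simp)+
    have "(Inl (e, i, False), Inl (e, \<not> i, False)) \<in> ?M\<^sup>*"
      by (cases i) (auto intro: r_into_rtrancl)
    then show "z \<in> ?M\<^sup>*" unfolding z using att' by (meson rtrancl_trans)
  qed
  moreover have "component_arcs G (insert e H) = component_arcs G H \<union> side_arcs {e}"
    by (auto simp: component_arcs_def side_arcs_def)
  moreover have "{(Inl (e, False, False), Inl (e, True, False)),
      (Inl (e, True, False), Inl (e, False, False))} \<subseteq> side_arcs {e}"
    by (auto simp: side_arcs_def)
  ultimately have "?M \<subseteq> component_arcs G (insert e H)" "component_arcs G (insert e H) \<subseteq> ?M\<^sup>*"
    by blast+
  then show ?thesis by (rule rtrancl_subset)
qed

lemma num_comp_insert_cases:
  assumes G: "ribbon_graph G" and e: "e \<in> edges G"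
  obtains "num_comp G (insert e H) = num_comp G H"
  | "num_comp G (insert e H) + 1 = num_comp G H"
    "(Inl (e, False, False), Inl (e, True, False)) \<notin> (component_arcs G H)\<^sup>*"
proof (cases "(Inl (e, False, False), Inl (e, True, False)) \<in> (component_arcs G H)\<^sup>*")
  case True
  then have "(Inl (e, True, False), Inl (e, False, False)) \<in> (component_arcs G H)\<^sup>*"
    using sym_rtrancl[OF sym_component_arcs[OF G]] by (auto dest: symD)
  with True have "(component_arcs G (insert e H))\<^sup>* = (component_arcs G H)\<^sup>*"
    unfolding component_arcs_insert[OF assms] by (intro rtrancl_subset) auto
  then show ?thesis using that by (simp add: num_comp_eq)
next
  case False
  have "num_comp G (insert e H) + 1 = num_comp G H"
    unfolding num_comp_eq component_arcs_insert[OF assms]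
    by (rule card_quotient_merge)
       (use sym_component_arcs[OF G] finite_points[OF G] e False in simp_all)
  with False show ?thesis using that by blast
qed

lemma boundary_arcs_subset_component_arcs:
  assumes "T \<subseteq> edges G"
  shows "boundary_arcs G T \<subseteq> component_arcs G T"
proof
  fix z assume "z \<in> boundary_arcs G T"
  then consider "z \<in> free_arcs G"
    | e i s where "z = (Inl (e, i, s), Inl (ribbon_arc T (e, i, s)))" "e \<in> edges G"
    unfolding boundary_arcs_def corners_def by blast
  then show "z \<in> component_arcs G T"
  proof cases
    case 2
    then show ?thesis
      by (cases "e \<in> T") (auto simp: component_arcs_def side_arcs_def attaching_arcs_def ribbon_arc_def)
  qed (simp add: component_arcs_def)
qed

text \<open>Boundary components lie inside components, so an edge joining two components has its
  diagonal corners on different boundary components. Read backwards: if inserting an edge does not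
  lower the boundary count, the components stay the same.\<close>

lemma num_bc_insert_of_num_comp_insert:
  assumes G: "ribbon_graph G" and T: "T \<subseteq> edges G" and e: "e \<in> edges G" "e \<notin> T"
    and c: "num_comp G (insert e T) \<noteq> num_comp G T"
  shows "num_comp G (insert e T) + 1 = num_comp G T" "num_bc G (insert e T) + 1 = num_bc G T"
proof -
  from num_comp_insert_cases[OF G e(1), of T] c
  have n: "num_comp G (insert e T) + 1 = num_comp G T"
    and sep: "(Inl (e, False, False), Inl (e, True, False)) \<notin> (component_arcs G T)\<^sup>*" by blast+
  show "num_comp G (insert e T) + 1 = num_comp G T" by (rule n)
  have att: "(Inl (e, True, True), Inl (e, True, False)) \<in> (component_arcs G T)\<^sup>*"
    using e by (intro r_into_rtrancl) (auto simp: component_arcs_def attaching_arcs_def)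
  have "(Inl (e, False, False), Inl (e, True, True)) \<notin> (component_arcs G T)\<^sup>*"
    using sep att by (meson rtrancl_trans)
  then have "(Inl (e, False, False), Inl (e, True, True)) \<notin> (boundary_arcs G T)\<^sup>*"
    using rtrancl_mono[OF boundary_arcs_subset_component_arcs[OF T]] by blast
  from num_bc_toggle_separated[OF G T e(1) this] e
  show "num_bc G (insert e T) + 1 = num_bc G T" by (simp add: toggle_def)
qed

section \<open>Growing edge sets, quasi-trees and the component graph\<close>

lemma num_bc_empty: "num_bc G {} = card (vertices G)"
  by (simp add: num_bc_def boundary_components_def vertices_def side_arcs_def)

lemma num_comp_empty: "num_comp G {} = card (vertices G)"
  by (simp add: num_comp_def components_def vertices_def side_arcs_def)

text \<open>The value is 0 without edges and never drops: an edge within a component adds at most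
  one boundary component, and for an edge joining two components the changes -2, +1 and +1 cancel.
  Hence \<open>nat\<close> is harmless in the exponents.\<close>

lemma s_param_nonneg:
  assumes G: "ribbon_graph G" and T: "T \<subseteq> edges G"
  shows "0 \<le> s_param G T"
proof -
  have "finite T" using T finite_edges[OF G] by (rule finite_subset)
  then show ?thesis using T
  proof induction
    case empty
    then show ?case by (simp add: s_param_def num_bc_empty num_comp_empty)
  next
    case (insert e T)
    then have e: "e \<in> edges G" "T \<subseteq> edges G" by auto
    have ge: "0 \<le> s_param G T" using insert by simp
    have card: "card (insert e T) = card T + 1" using insert by simp
    show ?case
    proof (cases "num_comp G (insert e T) = num_comp G T")
      case True
      have "num_bc G (insert e T) \<le> num_bc G T + 1"
        using num_bc_toggle_le[OF G e(2) e(1)] insert(2) by (simp add: toggle_def)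
      then show ?thesis using ge card True by (simp add: s_param_def)
    next
      case False
      from num_bc_insert_of_num_comp_insert[OF G e(2) e(1) insert(2) False] ge card
      show ?thesis by (simp add: s_param_def)
    qed
  qed
qed

lemma num_comp_le_add_card:
  assumes G: "ribbon_graph G" and H: "finite F" "F \<subseteq> edges G"
  shows "num_comp G H \<le> num_comp G (H \<union> F) + card F"
  using H
proof induction
  case (insert e F)
  then show ?case
    using num_comp_insert_cases[OF G, of e "H \<union> F" "num_comp G H \<le> num_comp G (H \<union> insert e F) + card (insert e F)"]
    by simp
qed simp

text \<open>At a set with the fewest boundary components no toggle can merge any, so the corners of
  each edge share a class. The boundary relation then contains all arcs of \<open>G\<close>, and
  connectedness leaves one class.\<close>

lemma exists_quasi_tree:
  assumes G: "ribbon_graph G" and conn: "connected_ribbon_graph G"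
  shows "quasi_trees G \<noteq> {}"
proof -
  have all: "points G \<noteq> {}" "\<And>x y. x \<in> points G \<Longrightarrow> y \<in> points G \<Longrightarrow> (x, y) \<in> (component_arcs G (edges G))\<^sup>*"
    using conn card_quotient_eq_1_iff[OF sym_component_arcs[OF G]]
    by (auto simp: connected_ribbon_graph_def num_comp_eq)
  define T where "T = arg_min_on (num_bc G) (Pow (edges G))"
  have fin: "finite (Pow (edges G))" using finite_edges[OF G] by simp
  then have T: "T \<subseteq> edges G" and min: "\<And>S. S \<subseteq> edges G \<Longrightarrow> num_bc G T \<le> num_bc G S"
    using arg_min_if_finite(1)[OF fin, of "num_bc G"] arg_min_least[OF fin, of _ "num_bc G"]
    unfolding T_def by auto
  let ?B = "boundary_arcs G T"
  have d: "(Inl (e, False, False), Inl (e, True, True)) \<in> ?B\<^sup>*" if "e \<in> edges G" for e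
  proof (rule ccontr)
    assume "\<not> ?thesis"
    from num_bc_toggle_separated[OF G T that this] min[OF toggle_subset[OF T that]]
    show False by simp
  qed
  have e: "(Inl c, Inl c') \<in> ?B\<^sup>*" if "fst c = e" "fst c' = e" "e \<in> edges G" for c c' e
    by (rule ribbon_corners_connected[OF sym_boundary_arcs[OF G] d, where T = T])
       (use that in \<open>simp_all add: ribbon_arcI r_into_rtrancl\<close>)
  have "component_arcs G (edges G) \<subseteq> ?B\<^sup>*"
    using e by (auto simp: component_arcs_def boundary_arcs_def attaching_arcs_def side_arcs_def)
  then have "(component_arcs G (edges G))\<^sup>* \<subseteq> ?B\<^sup>*"
    using rtrancl_subset_rtrancl by blast
  then have "num_bc G T = 1"
    unfolding num_bc_eq[OF T] card_quotient_eq_1_iff[OF sym_boundary_arcs[OF G]] using all by blast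
  then show ?thesis using T by (auto simp: quasi_trees_def)
qed

text \<open>The single boundary component of \<open>Q\<close> connects all points. All component
  counts subtracted in the exponents are evaluated this way.\<close>

lemma num_comp_eq_1_if_quasi_tree:
  assumes G: "ribbon_graph G" and Q: "Q \<in> quasi_trees G" and H: "Q \<subseteq> H"
  shows "num_comp G H = 1"
proof -
  have Q: "Q \<subseteq> edges G" "num_bc G Q = 1" using Q by (auto simp: quasi_trees_def)
  have "component_arcs G Q \<subseteq> component_arcs G H"
    using H by (auto simp: component_arcs_def side_arcs_def)
  then have "(boundary_arcs G Q)\<^sup>* \<subseteq> (component_arcs G H)\<^sup>*"
    using boundary_arcs_subset_component_arcs[OF Q(1)] by (intro rtrancl_mono) blast
  then show ?thesis
    using Q(2) unfolding num_bc_eq[OF Q(1)] num_comp_eq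
      card_quotient_eq_1_iff[OF sym_boundary_arcs[OF G]] card_quotient_eq_1_iff[OF sym_component_arcs[OF G]]
    by blast
qed

text \<open>Sending a point to its component for \<open>H\<close> contracts the arcs of
  \<open>H\<close> and turns each ribbon in \<open>F\<close> into an edge, so connectivity becomes
  reachability in the multigraph.\<close>

lemma mcomp_component_graph:
  assumes G: "ribbon_graph G" and F: "F \<subseteq> edges G"
  shows "mcomp (component_graph G H L) F = num_comp G (H \<union> F)"
proof -
  let ?K = "component_arcs G H" and ?K' = "component_arcs G (H \<union> F)"
  let ?cl = "\<lambda>x. ?K\<^sup>* `` {x}"
  let ?D = "{(u, v). \<exists>e\<in>F. u \<in> mends (component_graph G H L) e \<and> v \<in> mends (component_graph G H L) e}"
  have comps: "components G H = ?cl ` points G"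
    by (simp add: components_def component_arcs_def quotient_image)
  have ends: "mends (component_graph G H L) e = {?cl (Inl (e, i, s)) | i s. True}" if "e \<in> F" for e
  proof -
    have "C = ?cl (Inl (e, i, s))" if "C \<in> components G H" "Inl (e, i, s) \<in> C" for C i s
    proof -
      from that(1) obtain x where x: "C = ?cl x" unfolding comps by blast
      with that(2) have "(x, Inl (e, i, s)) \<in> ?K\<^sup>*" by simp
      then show ?thesis unfolding x sym_rtrancl_class_eq_iff[OF sym_component_arcs[OF G]] .
    qed
    moreover have "?cl (Inl (e, i, s)) \<in> components G H" "Inl (e, i, s) \<in> ?cl (Inl (e, i, s))" for i s
      using that F unfolding comps by auto
    ultimately show ?thesis unfolding component_graph_def multigraph.simps by blast
  qed
  have sD: "sym ?D" by (auto simp: sym_def)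
  have KK: "?K\<^sup>* \<subseteq> ?K'\<^sup>*" by (rule rtrancl_mono) (auto simp: component_arcs_def side_arcs_def)
  have same_edge: "(Inl (e, i, s), Inl (e, j, t)) \<in> ?K'\<^sup>*" if "e \<in> F" for e i s j t
  proof -
    have a: "(Inl (e, i, s), Inl (e, i, \<not> s)) \<in> ?K'\<^sup>*" for i s
      using that F by (intro r_into_rtrancl) (auto simp: component_arcs_def attaching_arcs_def)
    have b: "(Inl (e, i, s), Inl (e, \<not> i, s)) \<in> ?K'\<^sup>*" for i s
      using that F by (intro r_into_rtrancl) (auto simp: component_arcs_def side_arcs_def)
    have "(Inl (e, i, s), Inl (e, i, t)) \<in> ?K'\<^sup>*" using a[of i s] by (cases "s = t") auto
    moreover have "(Inl (e, i, t), Inl (e, j, t)) \<in> ?K'\<^sup>*" using b[of i t] by (cases "i = j") auto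
    ultimately show ?thesis by (rule rtrancl_trans)
  qed
  have fwd: "(?cl x, ?cl y) \<in> ?D\<^sup>*" if "(x, y) \<in> ?K'\<^sup>*" for x y
    using that
  proof induction
    case (step y z)
    have "(?cl y, ?cl z) \<in> ?D\<^sup>*"
    proof (cases "(y, z) \<in> ?K")
      case True
      then have "?cl y = ?cl z" unfolding sym_rtrancl_class_eq_iff[OF sym_component_arcs[OF G]] by blast
      then show ?thesis by simp
    next
      case False
      then obtain e i s where "e \<in> F" "y = Inl (e, i, s)" "z = Inl (e, \<not> i, s)"
        using step(2) unfolding component_arcs_def side_arcs_def by blast
      then have "(?cl y, ?cl z) \<in> ?D" using ends by blast
      then show ?thesis by (rule r_into_rtrancl)
    qed
    with step(3) show ?case by (rule rtrancl_trans)
  qed simp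
  \<comment> \<open>The claim covers all representatives, since consecutive edges of a path may meet
    a component at different corners.\<close>
  have bwd: "\<And>x y. U = ?cl x \<Longrightarrow> V = ?cl y \<Longrightarrow> (x, y) \<in> ?K'\<^sup>*" if "(U, V) \<in> ?D\<^sup>*" for U V
    using that
  proof induction
    case base
    then show ?case using KK sym_rtrancl_class_eq_iff[OF sym_component_arcs[OF G], of H] by blast
  next
    case (step V W)
    from step(2) obtain e where e: "e \<in> F" "V \<in> mends (component_graph G H L) e"
      "W \<in> mends (component_graph G H L) e" by blast
    from e(2) obtain i s where "V = ?cl (Inl (e, i, s))" unfolding ends[OF e(1)] by blast
    then have "(x, Inl (e, i, s)) \<in> ?K'\<^sup>*" by (rule step.IH[OF step.prems(1)])
    also from e(3) obtain j t where W: "W = ?cl (Inl (e, j, t))" unfolding ends[OF e(1)] by blast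
    have "(Inl (e, i, s), Inl (e, j, t)) \<in> ?K'\<^sup>*" by (rule same_edge[OF e(1)])
    also have "(Inl (e, j, t), y) \<in> ?K'\<^sup>*"
    proof -
      have "?cl (Inl (e, j, t)) = ?cl y" using W step.prems(2) by (rule trans[OF sym])
      then show ?thesis
        unfolding sym_rtrancl_class_eq_iff[OF sym_component_arcs[OF G]] using KK by blast
    qed
    finally show ?case .
  qed
  have "num_comp G (H \<union> F) = card (components G H // ?D\<^sup>*)"
    unfolding num_comp_eq
  proof (rule card_quotient_transfer[where f = ?cl])
    show "(x, y) \<in> ?K'\<^sup>* \<longleftrightarrow> (?cl x, ?cl y) \<in> ?D\<^sup>*" for x y
      using fwd bwd[OF _ refl refl] by (rule iffI)
  qed (use sym_component_arcs[OF G] sD comps in simp_all)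
  then show ?thesis by (simp add: mcomp_def) (simp add: component_graph_def)
qed

section \<open>Boundary components of partial duals\<close>

lemma partial_dual_simps [simp]:
  "edges (partial_dual G Q) = edges G"
  "corners (partial_dual G Q) = corners G"
  "points (partial_dual G Q) = points G"
  "free_arc (partial_dual G Q) c = flip Q (free_arc G (flip Q c))"
  by (simp_all add: partial_dual_def corners_def points_def)

lemma flip_flip [simp]: "flip Q (flip Q c) = c"
  by (auto simp: flip_def split: prod.splits)

lemma flip_corners [simp]: "flip Q c \<in> corners G \<longleftrightarrow> c \<in> corners G"
  by (cases c) (auto simp: flip_def)

text \<open>Flipping an edge exchanges its sides with its attaching arcs, which amounts to toggling
  its membership in \<open>T\<close>.\<close>

lemma flip_ribbon_arc: "flip Q (ribbon_arc T c) = ribbon_arc (sym_diff T Q) (flip Q c)"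
  by (cases c) (auto simp: flip_def ribbon_arc_def)

lemma partial_dual_partial_dual: "partial_dual (partial_dual G Q) Q = G"
  by (simp add: partial_dual_def comp_def)

lemma boundary_arcs_partial_dual:
  assumes "(x, y) \<in> boundary_arcs G T"
  shows "(map_sum (flip Q) id x, map_sum (flip Q) id y) \<in> boundary_arcs (partial_dual G Q) (sym_diff T Q)"
proof -
  from assms consider c where "x = Inl c" "y = Inl (free_arc G c)" "c \<in> corners G"
    | c where "x = Inl c" "y = Inl (ribbon_arc T c)" "c \<in> corners G"
    unfolding boundary_arcs_def free_arcs_def by blast
  then show ?thesis
  proof cases
    case (1 c)
    then show ?thesis using free_arcI[of "flip Q c" "partial_dual G Q"] by simp
  next
    case (2 c)
    then show ?thesis
      using ribbon_arcI[of "flip Q c" "partial_dual G Q" "sym_diff T Q"]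
      by (simp add: flip_ribbon_arc)
  qed
qed

lemma boundary_arcs_rtrancl_partial_dual:
  assumes "(x, y) \<in> (boundary_arcs G T)\<^sup>*"
  shows "(map_sum (flip Q) id x, map_sum (flip Q) id y) \<in> (boundary_arcs (partial_dual G Q) (sym_diff T Q))\<^sup>*"
  using assms by induction (blast intro: boundary_arcs_partial_dual rtrancl_into_rtrancl)+

text \<open>Up to the renaming of corners by \<open>flip Q\<close>, the two boundaries are the same
  system of curves.\<close>

lemma num_bc_partial_dual:
  assumes G: "ribbon_graph G" and T: "T \<subseteq> edges G" and Q: "Q \<subseteq> edges G"
  shows "num_bc (partial_dual G Q) (sym_diff T Q) = num_bc G T"
proof -
  let ?f = "map_sum (flip Q) (id :: 'b \<Rightarrow> 'b)"
  have ff: "?f (?f x) = x" for x by (cases x) auto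
  have sub: "?f ` points G \<subseteq> points G" by (auto simp: points_def)
  then have img: "?f ` points G = points G"
    using ff by (metis image_subset_iff subsetI subset_antisym image_eqI)
  have dd: "sym_diff (sym_diff T Q) Q = T" by auto
  have iff: "(x, y) \<in> (boundary_arcs G T)\<^sup>* \<longleftrightarrow>
    (?f x, ?f y) \<in> (boundary_arcs (partial_dual G Q) (sym_diff T Q))\<^sup>*" for x y
    using boundary_arcs_rtrancl_partial_dual[of x y G T Q]
      boundary_arcs_rtrancl_partial_dual[of "?f x" "?f y" "partial_dual G Q" "sym_diff T Q" Q]
    unfolding ff dd partial_dual_partial_dual by blast
  have "card (points G // (boundary_arcs G T)\<^sup>*) =
    card (points G // (boundary_arcs (partial_dual G Q) (sym_diff T Q))\<^sup>*)"
    by (rule card_quotient_transfer[OF _ _ img iff])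
       (simp_all add: sym_boundary_arcs G ribbon_graph_partial_dual)
  moreover have "sym_diff T Q \<subseteq> edges (partial_dual G Q)" using T Q by auto
  ultimately show ?thesis using num_bc_eq T by (metis partial_dual_simps(3))
qed

text \<open>Flipping all edges and those outside \<open>Q\<close> again leaves just \<open>Q\<close>
  flipped. So \<open>Q\<close> and its complement in the dual see the same one-vertex graph.\<close>

lemma partial_dual_dual:
  assumes "Q \<subseteq> edges G"
  shows "partial_dual (dual G) (edges G - Q) = partial_dual G Q"
proof -
  have "flip (edges G - Q) (flip (edges G) c) = flip Q c"
    "flip (edges G) (flip (edges G - Q) c) = flip Q c" for c
    using assms by (auto simp: flip_def split: prod.splits)
  then show ?thesis by (simp add: dual_def partial_dual_def comp_def)
qed

section \<open>One-vertex ribbon graphs\<close>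

text \<open>Without ribbons the boundary components are those of the vertex discs, so
  \<open>one\<close> asks for a single disc. Partial duals by quasi-trees are of this kind.\<close>

locale one_vertex =
  fixes G :: "('e, 'd) ribbon_graph"
  assumes G: "ribbon_graph G" and one: "num_bc G {} = 1"
begin

section \<open>The boundary traversal of the single disc\<close>

abbreviation N :: nat where "N \<equiv> 2 * card (edges G)"

abbreviation mu :: "'e corner \<Rightarrow> 'e corner" where "mu \<equiv> ribbon_arc {}"

abbreviation trav :: "'e corner \<Rightarrow> nat \<Rightarrow> 'e corner" where
  "trav p k \<equiv> (next_arc G ^^ k) p"

lemma mu_simp: "mu (e, i, s) = (e, i, \<not> s)"
  by (simp add: ribbon_arc_def)

lemma next_arc_eq: "next_arc G c = free_arc G (mu c)"
  by (cases c) (simp add: next_arc_def ribbon_arc_def)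

lemma free:
  assumes "c \<in> corners G"
  shows "free_arc G c \<in> corners G" "free_arc G (free_arc G c) = c" "free_arc G c \<noteq> c"
  using G assms unfolding ribbon_graph_def by blast+

lemma next_corner: "c \<in> corners G \<Longrightarrow> next_arc G c \<in> corners G"
  by (simp add: next_arc_eq free)

lemma trav_corner: "p \<in> corners G \<Longrightarrow> trav p k \<in> corners G"
  by (induction k) (auto intro: next_corner)

lemma next_inj: "c \<in> corners G \<Longrightarrow> d \<in> corners G \<Longrightarrow> next_arc G c = next_arc G d \<Longrightarrow> c = d"
  by (metis free(2) next_arc_eq ribbon_arc_corners ribbon_arc_involution)

lemma trav_inj: "c \<in> corners G \<Longrightarrow> d \<in> corners G \<Longrightarrow> trav c k = trav d k \<Longrightarrow> c = d"
proof (induction k)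
  case (Suc k)
  then show ?case using next_inj[of "trav c k" "trav d k"] trav_corner by simp
qed simp

lemma trav_add: "trav (trav p k) l = trav p (l + k)"
  by (simp add: funpow_add)

lemma next_mu_next: "c \<in> corners G \<Longrightarrow> next_arc G (mu (next_arc G c)) = mu c"
  by (simp add: next_arc_eq free)

text \<open>Entering the last arc from its other corner retraces the walk, until the first arc is
  entered from its other corner too.\<close>

lemma trav_mu_trav: "c \<in> corners G \<Longrightarrow> trav (mu (trav c k)) k = mu c"
proof (induction k)
  case (Suc k)
  have "trav (mu (trav c (Suc k))) (Suc k) = trav (next_arc G (mu (next_arc G (trav c k)))) k"
    by (simp add: funpow_swap1)
  also have "\<dots> = mu c" using Suc trav_corner by (simp add: next_mu_next)
  finally show ?case .
qed simp

text \<open>A walk returning to the other corner of its first arc would be its own reversal.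
  Halfway, \<open>mu\<close> (even length) or \<open>free_arc\<close> (odd length) would fix a
  corner.\<close>

lemma trav_neq_mu:
  assumes c: "c \<in> corners G"
  shows "trav c k \<noteq> mu c"
proof
  assume eq: "trav c k = mu c"
  let ?j = "k div 2"
  let ?d = "trav c ?j"
  have d: "?d \<in> corners G" "mu ?d \<in> corners G" using c trav_corner by auto
  have mu: "mu c = trav (mu ?d) ?j" using trav_mu_trav[OF c] by simp
  show False
  proof (cases "even k")
    case True
    then have "trav c k = trav ?d ?j" by (simp add: trav_add flip: mult_2)
    then have "?d = mu ?d" using eq mu trav_inj d by metis
    then show False using ribbon_arc_neq[of "{}" ?d] by simp
  next
    case False
    then have "k = ?j + Suc ?j" by presburger
    then have "trav c k = trav (next_arc G ?d) ?j" using trav_add[where p = c and k = "Suc ?j" and l = ?j] by simp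
    then have "next_arc G ?d = mu ?d" using eq mu trav_inj d next_corner by metis
    then show False using free(3)[OF d(2)] by (simp add: next_arc_eq)
  qed
qed

lemma trav_neq_mu_trav:
  assumes p: "p \<in> corners G"
  shows "trav p k \<noteq> mu (trav p l)"
proof (cases "l \<le> k")
  case True
  then show ?thesis
    using trav_neq_mu[OF trav_corner[OF p, of l], of "k - l"] by (simp add: trav_add)
next
  case False
  then have "trav p l \<noteq> mu (trav p k)"
    using trav_neq_mu[OF trav_corner[OF p, of k], of "l - k"] by (simp add: trav_add)
  then show ?thesis by (metis ribbon_arc_involution)
qed

text \<open>The corners met in one period and their \<open>mu\<close> partners are closed under both
  matchings, whose only class containing corners is that of the disc.\<close>

lemma trav_cover:
  assumes p: "p \<in> corners G" and m: "m > 0" "trav p m = p" and c: "c \<in> corners G"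
  shows "\<exists>k<m. c = trav p k \<or> c = mu (trav p k)"
proof -
  define A where "A = {c. \<exists>k<m. c = trav p k \<or> c = mu (trav p k)}"
  have closed: "free_arc G c \<in> A \<and> mu c \<in> A" if "c \<in> A" for c
  proof -
    from that obtain k where k: "k < m" "c = trav p k \<or> c = mu (trav p k)"
      unfolding A_def by blast
    have "mu c \<in> A" using k unfolding A_def by auto
    moreover have "free_arc G c \<in> A"
      using k(2)
    proof
      assume c: "c = trav p k"
      define j where "j = (if k = 0 then m - 1 else k - 1)"
      have j: "j < m" "trav p (Suc j) = c"
        using k(1) m c by (auto simp: j_def simp del: funpow.simps)
      then have "free_arc G c = mu (trav p j)"
        using free(2)[of "mu (trav p j)"] trav_corner[OF p, of j] by (simp add: next_arc_eq)
      then show ?thesis using j unfolding A_def by auto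
    next
      assume c: "c = mu (trav p k)"
      then have f: "free_arc G c = trav p (Suc k)" by (simp add: next_arc_eq)
      show ?thesis
      proof (cases "Suc k < m")
        case False
        then have "Suc k = m" using k(1) by simp
        then have "free_arc G c = trav p 0" using f m by simp
        then show ?thesis using m(1) unfolding A_def by blast
      qed (use f in \<open>auto simp: A_def\<close>)
    qed
    ultimately show ?thesis by blast
  qed
  have pc: "(Inl p, Inl c) \<in> (boundary_arcs G {})\<^sup>*"
    using one p c unfolding num_bc_eq[OF empty_subsetI] card_quotient_eq_1_iff[OF sym_boundary_arcs[OF G]]
    by auto
  have "z \<in> Inl ` A" if "(Inl p, z) \<in> (boundary_arcs G {})\<^sup>*" for z
    using that
  proof induction
    case base
    have "p \<in> A" unfolding A_def using m(1) by (auto intro!: exI[of _ 0])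
    then show ?case by blast
  next
    case (step y z)
    then obtain d where d: "d \<in> A" "y = Inl d" by blast
    from step(2) d(2) have "z = Inl (free_arc G d) \<or> z = Inl (mu d)"
      unfolding boundary_arcs_def free_arcs_def by blast
    then show ?case using closed[OF d(1)] by blast
  qed
  from this[OF pc] have "c \<in> A" by blast
  then show ?thesis unfolding A_def by blast
qed

text \<open>At the first return time \<open>m\<close>, the \<open>m\<close> corners entered and
  their \<open>mu\<close> partners are disjoint and exhaust the four corners of every edge, so
  \<open>m = N\<close>.\<close>

lemma traversal:
  assumes p: "p \<in> corners G"
  shows trav_N: "trav p N = p" and inj_trav: "inj_on (trav p) {..<N}"
proof -
  have "\<not> inj (trav p)"
  proof
    assume "inj (trav p)"
    then have "infinite (range (trav p))" using finite_imageD by blast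
    moreover have "range (trav p) \<subseteq> corners G" using trav_corner[OF p] by blast
    ultimately show False using finite_corners[OF G] finite_subset by blast
  qed
  then obtain k l where kl: "k < l" "trav p k = trav p l"
    unfolding inj_def by (metis linorder_neqE_nat)
  have return: "trav p (l - k) = p" if "k < l" "trav p k = trav p l" for k l
  proof -
    have "trav (trav p (l - k)) k = trav p k" using that by (simp add: trav_add)
    then show ?thesis using trav_inj[OF trav_corner[OF p] p] by blast
  qed
  define m where "m = (LEAST m. 0 < m \<and> trav p m = p)"
  have m: "0 < m" "trav p m = p"
    using LeastI[of "\<lambda>m. 0 < m \<and> trav p m = p" "l - k"] return[OF kl] kl(1)
    unfolding m_def by auto
  have least: "m \<le> j" if "0 < j" "trav p j = p" for j
    unfolding m_def using that by (intro Least_le) simp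
  have inj: "inj_on (trav p) {..<m}"
  proof (rule linorder_inj_onI)
    show "trav p i \<noteq> trav p j" if "i < j" "i \<in> {..<m}" "j \<in> {..<m}" for i j
      using return[of i j] least[of "j - i"] that by auto
  qed auto
  let ?O = "trav p ` {..<m}"
  have "corners G = ?O \<union> mu ` ?O"
    using trav_cover[OF p m] trav_corner[OF p] by (auto simp: image_iff) blast+
  moreover have "?O \<inter> mu ` ?O = {}" using trav_neq_mu_trav[OF p] by blast
  moreover have "card (mu ` ?O) = card ?O"
    by (rule card_image) (metis inj_onI ribbon_arc_involution)
  ultimately have "card (corners G) = 2 * m"
    using card_image[OF inj] by (simp add: card_Un_disjoint)
  moreover have "card (corners G) = 4 * card (edges G)"
    by (simp add: corners_def card_cartesian_product card_UNIV_bool flip: UNIV_Times_UNIV)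
  ultimately have "m = N" by simp
  then show "trav p N = p" "inj_on (trav p) {..<N}" using m inj by auto
qed

section \<open>Positions of the attaching arcs in the traversal\<close>

lemma ribbon_arc_notin: "fst c \<notin> T \<Longrightarrow> ribbon_arc T c = mu c"
  by (cases c) (simp add: ribbon_arc_def)

lemma trav_periodic: "p \<in> corners G \<Longrightarrow> trav p (k + N * j) = trav p k"
proof (induction j)
  case (Suc j)
  have "trav p (k + N * Suc j) = trav (trav p N) (k + N * j)"
    by (simp only: trav_add) (simp add: algebra_simps)
  also have "\<dots> = trav p k" using Suc trav_N[OF Suc.prems] by simp
  finally show ?case .
qed simp

lemma N_pos: "e \<in> edges G \<Longrightarrow> 0 < N"
  using finite_edges[OF G] card_gt_0_iff by fastforce

lemma corner_edge: "p \<in> corners G \<Longrightarrow> fst p \<in> edges G"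
  by (auto simp: corners_def)

lemma cover_N:
  assumes "p \<in> corners G" "c \<in> corners G"
  shows "\<exists>k<N. c = trav p k \<or> c = mu (trav p k)"
  using trav_cover[OF assms(1) N_pos[OF corner_edge[OF assms(1)]] trav_N[OF assms(1)] assms(2)] .

text \<open>By periodicity, going back is going forward: the witness is
  \<open>i + (N * n - n)\<close>, where \<open>n \<le> N * n\<close> keeps the subtraction
  exact.\<close>

lemma trav_rewind:
  assumes p: "p \<in> corners G"
  shows "\<exists>j. trav (trav p j) n = trav p i"
proof -
  have "n \<le> N * n" using N_pos[OF corner_edge[OF p]] by (cases N) auto
  then have "n + (i + (N * n - n)) = i + N * n" by linarith
  then have "trav (trav p (i + (N * n - n))) n = trav p (i + N * n)" unfolding trav_add by (rule arg_cong)
  then show ?thesis using trav_periodic[OF p] by metis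
qed

lemma position_unique:
  assumes p: "p \<in> corners G" and "k < N" "l < N" "trav p k = (e, i, s)" "trav p l = (e, i, t)"
  shows "k = l"
proof (cases "s = t")
  case True
  then show ?thesis using inj_onD[OF inj_trav[OF p], of k l] assms by simp
next
  case False
  then have "trav p k = mu (trav p l)" using assms by (simp add: mu_simp)
  then show ?thesis using trav_neq_mu_trav[OF p] by blast
qed

lemma position_exists:
  assumes p: "p \<in> corners G" and e: "e \<in> edges G"
  shows "\<exists>k<N. \<exists>s. trav p k = (e, i, s)"
proof -
  obtain k where k: "k < N" "(e, i, False) = trav p k \<or> (e, i, False) = mu (trav p k)"
    using cover_N[OF p, of "(e, i, False)"] e by auto
  have "trav p k = (e, i, True)" if "(e, i, False) = mu (trav p k)"
  proof -
    have "mu (e, i, False) = trav p k" using that by simp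
    then show ?thesis by (simp add: mu_simp)
  qed
  then show ?thesis using k by metis
qed

text \<open>The witness in \<open>orientable_loop\<close> may run in either direction; this reads
  orientability off one fixed traversal.\<close>

lemma orientable_loop_iff:
  assumes p: "p \<in> corners G" and i: "trav p i = (e, False, a)" and k: "trav p k = (e, True, b)"
  shows "orientable_loop G e \<longleftrightarrow> a \<noteq> b"
proof
  assume "a \<noteq> b"
  have "i \<le> N * i" using N_pos[OF corner_edge[OF p]] by (cases N) auto
  then have "k + (N * i - i) + i = k + N * i" by linarith
  then have "trav (trav p i) (k + (N * i - i)) = trav p (k + N * i)" unfolding trav_add by (rule arg_cong)
  then have "trav (e, False, a) (k + (N * i - i)) = (e, True, \<not> a)"
    unfolding trav_periodic[OF p] i k using \<open>a \<noteq> b\<close> by auto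
  then show "orientable_loop G e" unfolding orientable_loop_def by blast
next
  assume "orientable_loop G e"
  then obtain s n where sn: "trav (e, False, s) n = (e, True, \<not> s)"
    unfolding orientable_loop_def by blast
  show "a \<noteq> b"
  proof
    assume ab: "a = b"
    show False
    proof (cases "s = a")
      case True
      then have "trav p (n + i) = mu (trav p k)"
        using sn i k ab trav_add[where p = p and k = i and l = n] by (simp add: mu_simp)
      then show False using trav_neq_mu_trav[OF p] by blast
    next
      case False
      \<comment> \<open>Here the witness runs against the traversal from \<open>p\<close>, so it is
        reversed.\<close>
      obtain j where j: "trav (trav p j) n = trav p i" using trav_rewind[OF p] by blast
      have "mu (trav p j) = trav (mu (trav p i)) n"
        using trav_mu_trav[OF trav_corner[OF p, of j], of n] j by simp
      also have "\<dots> = trav p k"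
        using False i k sn ab by (simp add: mu_simp)
      finally show False using trav_neq_mu_trav[OF p] by metis
    qed
  qed
qed

lemma position_cases:
  assumes p: "p \<in> corners G" and ik: "i \<noteq> k" "i < N" "k < N" "fst (trav p i) = e" "fst (trav p k) = e"
    and l: "l < N" "fst (trav p l) = e"
  shows "l = i \<or> l = k"
proof -
  obtain a s b t c u where *: "trav p i = (e, a, s)" "trav p k = (e, b, t)" "trav p l = (e, c, u)"
    using ik l by (metis prod.collapse)
  have "a \<noteq> b" using position_unique[OF p ik(2,3)] * ik(1) by blast
  then have "c = a \<or> c = b" by blast
  then show ?thesis
    using position_unique[OF p l(1) ik(2)] position_unique[OF p l(1) ik(3)] * by blast
qed

lemma orientable_positions:
  assumes p: "p \<in> corners G" and ik: "i \<noteq> k" "i < N" "k < N" "fst (trav p i) = e" "fst (trav p k) = e"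
    and o: "orientable_loop G e"
  obtains a s where "trav p i = (e, a, s)" "trav p k = (e, \<not> a, \<not> s)"
proof -
  obtain a s b t where *: "trav p i = (e, a, s)" "trav p k = (e, b, t)"
    using ik by (metis prod.collapse)
  have "a \<noteq> b" using position_unique[OF p ik(2,3)] * ik(1) by blast
  moreover have "s \<noteq> t"
  proof (cases a)
    case True
    then show ?thesis using orientable_loop_iff[OF p, of k e t i s] * o \<open>a \<noteq> b\<close> by auto
  next
    case False
    then show ?thesis using orientable_loop_iff[OF p, of i e s k t] * o \<open>a \<noteq> b\<close> by auto
  qed
  ultimately show ?thesis using * that by auto
qed

text \<open>
  If the arcs \<open>i\<close> and \<open>k\<close> belong to the same orientable edge, then toggling this edge joins the two
  ends of the segment. An edge not linked to it has all or none of its corners on the segment, so the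
  segment remains a union of boundary components when such edges are toggled as well.
\<close>

definition segment :: "'e corner \<Rightarrow> nat \<Rightarrow> nat \<Rightarrow> 'e corner set" where
  "segment p i k = trav p ` {i<..k} \<union> mu ` trav p ` {i..<k}"

text \<open>A segment runs from the far corner of arc \<open>i\<close> to the entry corner of arc
  \<open>k\<close>, whence the different bounds for entry and far corners.\<close>

lemma trav_mem_segment:
  assumes p: "p \<in> corners G" and "k < N" "l < N"
  shows "trav p l \<in> segment p i k \<longleftrightarrow> i < l \<and> l \<le> k"
    "mu (trav p l) \<in> segment p i k \<longleftrightarrow> i \<le> l \<and> l < k"
proof -
  have inj: "trav p l = trav p j \<longleftrightarrow> l = j" if "j < N" for j
    using inj_on_eq_iff[OF inj_trav[OF p], of l j] assms that by simp
  have inj': "mu (trav p l) = mu (trav p j) \<longleftrightarrow> l = j" if "j < N" for j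
    using inj[OF that] by (metis ribbon_arc_involution)
  show "trav p l \<in> segment p i k \<longleftrightarrow> i < l \<and> l \<le> k"
  proof
    assume "trav p l \<in> segment p i k"
    then obtain j where "i < j" "j \<le> k" "trav p l = trav p j"
      unfolding segment_def using trav_neq_mu_trav[OF p] by auto
    then show "i < l \<and> l \<le> k" using inj[of j] assms by auto
  qed (simp add: segment_def)
  show "mu (trav p l) \<in> segment p i k \<longleftrightarrow> i \<le> l \<and> l < k"
  proof
    assume "mu (trav p l) \<in> segment p i k"
    then obtain j where "i \<le> j" "j < k" "mu (trav p l) = mu (trav p j)"
      unfolding segment_def using trav_neq_mu_trav[OF p] by (auto dest: sym)
    then show "i \<le> l \<and> l < k" using inj'[of j] assms by auto
  qed (simp add: segment_def)
qed

text \<open>By \<open>chords\<close>, no other edge of \<open>W\<close> has one arc strictly inside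
  and one elsewhere. For edges outside \<open>W\<close>, \<open>ribbon_arc W\<close> is
  \<open>mu\<close> and stays at its position.\<close>

lemma segment_closed:
  assumes p: "p \<in> corners G" and ik: "i < k" "k < N" "fst (trav p i) = e" "fst (trav p k) = e"
    and o: "orientable_loop G e" and W: "e \<in> W"
    and chords: "\<forall>l<N. \<forall>l'<N. fst (trav p l) = fst (trav p l') \<and>
      fst (trav p l) \<in> W - {e} \<and> i < l \<and> l < k \<longrightarrow> i < l' \<and> l' < k"
    and c: "c \<in> segment p i k"
  shows "free_arc G c \<in> segment p i k" "ribbon_arc W c \<in> segment p i k"
proof -
  have iN: "i < N" using ik by simp
  from c consider l where "i < l" "l \<le> k" "c = trav p l" | l where "i \<le> l" "l < k" "c = mu (trav p l)"
    unfolding segment_def by auto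
  then show "free_arc G c \<in> segment p i k"
  proof cases
    case (1 l)
    then obtain j where j: "l = Suc j" by (cases l) auto
    then have "free_arc G c = mu (trav p j)"
      using 1 free(2)[of "mu (trav p j)"] trav_corner[OF p, of j] by (simp add: next_arc_eq)
    then show ?thesis using 1 j by (auto simp: segment_def)
  next
    case (2 l)
    then have "free_arc G c = trav p (Suc l)" by (simp add: next_arc_eq)
    moreover have "Suc l \<in> {i<..k}" using 2 by simp
    ultimately show ?thesis unfolding segment_def by blast
  qed
  have cc: "c \<in> corners G"
    using c trav_corner[OF p] unfolding segment_def by auto
  have "segment p i k \<subseteq> trav p ` {i..k} \<union> mu ` trav p ` {i..k}"
    unfolding segment_def by (intro Un_mono image_mono) auto
  with c obtain l where "l \<in> {i..k}" and "c = trav p l \<or> c = mu (trav p l)" by blast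
  then have l: "i \<le> l" "l \<le> k" "c = trav p l \<or> c = mu (trav p l)" by simp_all
  have lN: "l < N" using l ik by simp
  have fl: "fst (trav p l) = fst c" using l(3) by auto
  show "ribbon_arc W c \<in> segment p i k"
  proof (cases "fst c = e")
    case True
    obtain a s where as: "trav p i = (e, a, s)" "trav p k = (e, \<not> a, \<not> s)"
      using orientable_positions[OF p _ iN ik(2-4) o] ik(1) by blast
    have "l = i \<or> l = k"
      using position_cases[OF p _ iN ik(2-4) lN] ik(1) True fl by auto
    then have "c = mu (trav p i) \<or> c = trav p k"
      using l(3) trav_mem_segment[OF p ik(2) iN, of i] trav_mem_segment[OF p ik(2) ik(2), of i] c by auto
    \<comment> \<open>Orientability puts the far corner of arc \<open>i\<close> and the entry corner
      of arc \<open>k\<close> on the same side of the ribbon, so this side closes up the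
      segment.\<close>
    then have "ribbon_arc W c = trav p k \<or> ribbon_arc W c = mu (trav p i)"
      using as W by (auto simp: ribbon_arc_def)
    then show ?thesis
      using trav_mem_segment[OF p ik(2) iN, of i] trav_mem_segment[OF p ik(2) ik(2), of i] ik(1) by auto
  next
    case False
    then have ne: "l \<noteq> i" "l \<noteq> k" using fl ik by auto
    then have lik: "i < l" "l < k" using l by auto
    obtain l' where l': "l' < N" "ribbon_arc W c = trav p l' \<or> ribbon_arc W c = mu (trav p l')"
      using cover_N[OF p] cc by (metis ribbon_arc_corners)
    have fl': "fst (trav p l') = fst c" using l'(2) by (metis fst_ribbon_arc)
    have "i < l' \<and> l' < k"
    proof (cases "fst c \<in> W")
      case True
      then show ?thesis 
        using chords[rule_format, of l l'] lN l'(1) fl fl' False lik by (simp only: Diff_iff singleton_iff) blast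
    next
      case nW: False
      then have "ribbon_arc W c = mu c" by (rule ribbon_arc_notin)
      then have "ribbon_arc W c = trav p l \<or> ribbon_arc W c = mu (trav p l)" using l(3) by auto
      then have "trav p l = trav p l'"
        using l'(2) trav_neq_mu_trav[OF p] by (metis ribbon_arc_involution)
      then have "l = l'" using inj_on_eq_iff[OF inj_trav[OF p], of l l'] lN l'(1) by simp
      then show ?thesis using lik by simp
    qed
    then show ?thesis
      using l'(2) trav_mem_segment[OF p ik(2) l'(1), of i] by auto
  qed
qed

lemma segment_boundary_closed:
  assumes p: "p \<in> corners G" and ik: "i < k" "k < N" "fst (trav p i) = e" "fst (trav p k) = e"
    and o: "orientable_loop G e" and W: "e \<in> W"
    and chords: "\<forall>l<N. \<forall>l'<N. fst (trav p l) = fst (trav p l') \<and>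
      fst (trav p l) \<in> W - {e} \<and> i < l \<and> l < k \<longrightarrow> i < l' \<and> l' < k"
    and c: "(Inl c, Inl d) \<in> (boundary_arcs G W)\<^sup>*"
  shows "c \<in> segment p i k \<longleftrightarrow> d \<in> segment p i k"
proof -
  have *: "z \<in> Inl ` segment p i k" if "(Inl c, z) \<in> (boundary_arcs G W)\<^sup>*" "c \<in> segment p i k" for c z
    using that
  proof (induction rule: rtrancl_induct)
    case (step y z)
    then obtain b where b: "b \<in> segment p i k" "y = Inl b" by blast
    from step(2) b(2) have "z = Inl (free_arc G b) \<or> z = Inl (ribbon_arc W b)"
      unfolding boundary_arcs_def free_arcs_def by blast
    then show ?case using segment_closed[OF p ik o W chords b(1)] by blast
  qed blast
  have "(Inl d, Inl c) \<in> (boundary_arcs G W)\<^sup>*"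
    using c by (rule symD[OF sym_rtrancl[OF sym_boundary_arcs[OF G]]])
  then show ?thesis using * c by blast
qed

text \<open>The segment contains exactly two corners of \<open>e\<close>, both on the same side of
  the ribbon, hence just one of the diagonal corners.\<close>

lemma segment_separates:
  assumes p: "p \<in> corners G" and ik: "i < k" "k < N" "fst (trav p i) = e" "fst (trav p k) = e"
    and o: "orientable_loop G e" and W: "e \<in> W"
    and chords: "\<forall>l<N. \<forall>l'<N. fst (trav p l) = fst (trav p l') \<and>
      fst (trav p l) \<in> W - {e} \<and> i < l \<and> l < k \<longrightarrow> i < l' \<and> l' < k"
  shows "(Inl (e, False, False), Inl (e, True, True)) \<notin> (boundary_arcs G W)\<^sup>*"
proof
  assume "(Inl (e, False, False), Inl (e, True, True)) \<in> (boundary_arcs G W)\<^sup>*"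
  note iff = segment_boundary_closed[OF p ik o W chords this]
  have iN: "i < N" using ik by simp
  obtain a s where as: "trav p i = (e, a, s)" "trav p k = (e, \<not> a, \<not> s)"
    using orientable_positions[OF p _ iN ik(2-4) o] ik(1) by blast
  have "(e, a, s) \<notin> segment p i k" "(e, a, \<not> s) \<in> segment p i k"
    using trav_mem_segment[OF p ik(2) iN, of i] as(1) ik(1) by (simp_all add: mu_simp)
  moreover have "(e, \<not> a, \<not> s) \<in> segment p i k" "(e, \<not> a, s) \<notin> segment p i k"
    using trav_mem_segment[OF p ik(2) ik(2), of i] as(2) ik(1) by (simp_all add: mu_simp)
  ultimately show False using iff by (cases a; cases s) auto
qed

section \<open>Toggling linked and unlinked edges\<close>

lemma boundary_word_nth: "l < N \<Longrightarrow> boundary_word G p ! l = fst (trav p l)"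
  by (simp add: boundary_word_def)

lemma length_boundary_word: "length (boundary_word G p) = N"
  by (simp add: boundary_word_def)

text \<open>A traversal from a corner of \<open>e\<close> meets \<open>e\<close> at positions 0 and
  \<open>k\<close>. An edge with one arc between them and one beyond \<open>k\<close> would
  alternate with \<open>e\<close>, so \<open>segment_separates\<close> applies.\<close>

lemma separated_if_not_alternate:
  assumes e: "e \<in> edges G" and o: "orientable_loop G e" and W: "e \<in> W"
    and na: "\<And>f. f \<in> W - {e} \<Longrightarrow> \<not> alternate G e f"
  shows "(Inl (e, False, False), Inl (e, True, True)) \<notin> (boundary_arcs G W)\<^sup>*"
proof -
  define p where "p = (e, False, False)"
  have p: "p \<in> corners G" using e by (simp add: p_def)
  obtain k s where k: "k < N" "trav p k = (e, True, s)" using position_exists[OF p e] by blast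
  have k0: "0 < k" using k(2) by (cases k) (auto simp: p_def)
  show ?thesis
  proof (rule segment_separates[OF p k0 k(1) _ _ o W], goal_cases)
    case 3
    show ?case
    proof (intro allI impI, elim conjE)
      fix l l' assume ll: "l < N" "l' < N" "fst (trav p l) = fst (trav p l')"
        "fst (trav p l) \<in> W - {e}" "0 < l" "l < k"
      define f where "f = fst (trav p l)"
      have ek: "fst (trav p 0) = e" "fst (trav p k) = e" using k(2) by (simp_all add: p_def)
      have el': "fst (trav p l') \<noteq> e" using ll(3,4) by simp
      have "l' \<noteq> 0" using ek(1) el' by metis
      moreover have "l' \<noteq> k" using ek(2) el' by metis
      moreover have "\<not> k < l'"
      proof
        assume "k < l'"
        then have "alternate G e f"
          unfolding alternate_def length_boundary_word using p ll k
          by (intro bexI[of _ p] exI[of _ 0] exI[of _ l] exI[of _ k] exI[of _ l'])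
             (auto simp: boundary_word_nth f_def p_def)
        then show False using na ll by (simp add: f_def)
      qed
      ultimately show "0 < l' \<and> l' < k" by simp
    qed
  qed (use k in \<open>auto simp: p_def\<close>)
qed

lemma num_bc_pos:
  assumes "e \<in> edges G" "T \<subseteq> edges G"
  shows "0 < num_bc G T"
proof -
  have "Inl (e, False, False) \<in> points G" using assms by simp
  then show ?thesis
    unfolding num_bc_eq[OF assms(2)] quotient_image card_gt_0_iff using finite_points[OF G] by blast
qed

text \<open>The stretch between the two arcs of \<open>e\<close> survives the toggle.
  Nonorientability makes it join opposite corners, so with the sides of the ribbon it connects all
  four, and toggling back cannot lower the count.\<close>

lemma num_bc_nonorientable:
  assumes e: "e \<in> edges G" and no: "\<not> orientable_loop G e"
  shows "num_bc G {e} = 1"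
proof -
  define p where "p = (e, False, False)"
  let ?B = "boundary_arcs G {e}"
  have p: "p \<in> corners G" using e by (simp add: p_def)
  obtain k s where k: "k < N" "trav p k = (e, True, s)" using position_exists[OF p e] by blast
  have k0: "0 < k" using k(2) by (cases k) (auto simp: p_def)
  have s: "\<not> s" using orientable_loop_iff[OF p, of 0 e False k s] no k by (simp add: p_def)
  have "(Inl (mu p), Inl (trav p (Suc l))) \<in> ?B\<^sup>*" if "l < k" for l
    using that
  proof (induction l)
    case 0
    then show ?case using free_arcI[of "mu p" G "{e}"] p by (simp add: next_arc_eq)
  next
    case (Suc l)
    let ?c = "trav p (Suc l)"
    have c: "?c \<in> corners G" by (rule trav_corner[OF p])
    have "fst ?c \<noteq> e"
      using position_cases[OF p, of 0 k e "Suc l"] Suc.prems k k0 by (auto simp: p_def)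
    then have "ribbon_arc {e} ?c = mu ?c" by (intro ribbon_arc_notin) simp
    then have "(Inl ?c, Inl (mu ?c)) \<in> ?B" using ribbon_arcI[OF c, of "{e}"] by simp
    moreover have "(Inl (mu ?c), Inl (trav p (Suc (Suc l)))) \<in> ?B"
      using free_arcI[of "mu ?c" G "{e}"] c by (simp add: next_arc_eq)
    moreover have "(Inl (mu p), Inl ?c) \<in> ?B\<^sup>*" using Suc by simp
    ultimately show ?case by (meson rtrancl_into_rtrancl)
  qed
  from this[of "k - 1"] have "(Inl (mu p), Inl (trav p k)) \<in> ?B\<^sup>*" using k0 by simp
  then have path: "(Inl (e, False, True), Inl (e, True, False)) \<in> ?B\<^sup>*"
    using k(2) s by (simp add: p_def mu_simp)
  have side: "(Inl (e, i, t), Inl (e, \<not> i, t)) \<in> ?B" for i t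
    using ribbon_arcI[of "(e, i, t)" G "{e}"] e by (simp add: ribbon_arc_def)
  have "(Inl (e, True, False), Inl (e, False, True)) \<in> ?B\<^sup>*"
    using path by (rule symD[OF sym_rtrancl[OF sym_boundary_arcs[OF G]]])
  then have "(Inl (e, False, False), Inl (e, True, True)) \<in> ?B\<^sup>*"
    using side[of False False] side[of False True]
    by (metis (full_types) converse_rtrancl_into_rtrancl rtrancl_into_rtrancl)
  from num_bc_toggle_not_separated[OF G _ e this] e
  have "num_bc G {e} \<le> 1" using one by (simp add: toggle_def)
  then show ?thesis using num_bc_pos[OF e, of "{e}"] e by simp
qed

text \<open>Toggling \<open>e\<close> alone splits the boundary in two along a segment. As
  \<open>f\<close> has one arc inside and one outside, toggling it merges the two parts
  again.\<close>

lemma num_bc_linked: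
  assumes e: "e \<in> edges G" and f: "f \<in> edges G" "f \<noteq> e"
    and o: "orientable_loop G e" and alt: "alternate G e f"
  shows "num_bc G {e, f} = 1"
proof -
  obtain p i j k l where p: "p \<in> corners G" and ord: "i < j" "j < k" "k < l" "l < N"
    and w: "fst (trav p i) = e" "fst (trav p j) = f" "fst (trav p k) = e" "fst (trav p l) = f"
  proof -
    from alt obtain p i j k l where *: "p \<in> corners G" "i < j" "j < k" "k < l" "l < N"
      "boundary_word G p ! i = e" "boundary_word G p ! j = f"
      "boundary_word G p ! k = e" "boundary_word G p ! l = f"
      unfolding alternate_def length_boundary_word by blast
    with that[of p i j k l] show ?thesis
      using boundary_word_nth[of i p] boundary_word_nth[of j p] boundary_word_nth[of k p]
        boundary_word_nth[of l p] by simp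
  qed
  have kN: "k < N" "j < N" and ik: "i < k" using ord by auto
  have two: "num_bc G {e} = 2"
    using num_bc_toggle_separated[OF G _ e segment_separates[OF p ik kN(1) w(1,3) o, where W = "{e}"]] e one
    by (simp add: toggle_def)
  have "(Inl (f, False, False), Inl (f, True, True)) \<notin> (boundary_arcs G {e})\<^sup>*"
  proof
    assume d: "(Inl (f, False, False), Inl (f, True, True)) \<in> (boundary_arcs G {e})\<^sup>*"
    have "(Inl (trav p j), Inl (trav p l)) \<in> (boundary_arcs G {e})\<^sup>*"
      by (rule ribbon_corners_connected[OF sym_boundary_arcs[OF G] d, where T = "{e}"])
         (use f w in \<open>simp_all add: ribbon_arcI r_into_rtrancl\<close>)
    from segment_boundary_closed[OF p ik kN(1) w(1,3) o _ _ this]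
    show False
      using trav_mem_segment(1)[OF p kN(1) kN(2), of i] trav_mem_segment(1)[OF p kN(1) ord(4), of i] ord
      by simp
  qed
  from num_bc_toggle_separated[OF G _ f(1) this] e f two show ?thesis
    by (simp add: toggle_def insert_commute)
qed

end

section \<open>Resolving a set along a linear order\<close>

text \<open>An arbitrary family keeps the resolution argument purely order-theoretic; for
  quasi-trees, forced turns out to mean live and orientable.\<close>

definition forced :: "'e rel \<Rightarrow> 'e set \<Rightarrow> 'e set set \<Rightarrow> 'e set \<Rightarrow> 'e \<Rightarrow> bool" where
  "forced r E \<Q> Q e \<longleftrightarrow> (\<forall>Q'\<in>\<Q>. (\<forall>f\<in>E. (e, f) \<in> r \<and> f \<noteq> e \<longrightarrow> (f \<in> Q' \<longleftrightarrow> f \<in> Q)) \<longrightarrow>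
     (e \<in> Q' \<longleftrightarrow> e \<in> Q))"

lemma linear_order_on_card_less:
  assumes lin: "linear_order_on E r" and fin: "finite E" and ef: "(e, f) \<in> r" "e \<noteq> f"
  shows "card {g \<in> E. (g, e) \<in> r} < card {g \<in> E. (g, f) \<in> r}"
proof (rule psubset_card_mono)
  have "trans r" "antisym r" "refl_on E r" "r \<subseteq> E \<times> E"
    using lin by (auto simp: order_on_defs)
  then have "f \<in> E" "(f, f) \<in> r" "(f, e) \<notin> r" "\<And>g. (g, e) \<in> r \<Longrightarrow> (g, f) \<in> r"
    using ef by (auto dest: antisymD transD refl_onD)
  then show "{g \<in> E. (g, e) \<in> r} \<subset> {g \<in> E. (g, f) \<in> r}" by blast
qed (use fin in simp)

lemma linear_order_on_cases:
  assumes "linear_order_on E r" "e \<in> E" "f \<in> E"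
  obtains "e = f" | "(e, f) \<in> r" "e \<noteq> f" "(f, e) \<notin> r" | "(f, e) \<in> r" "e \<noteq> f" "(e, f) \<notin> r"
  using assms by (auto simp: order_on_defs total_on_def dest: antisymD)

lemma exists_greatest_linear_order_on:
  assumes lin: "linear_order_on E r" and "finite S" "S \<noteq> {}" "S \<subseteq> E"
  shows "\<exists>e\<in>S. \<forall>f\<in>S. (f, e) \<in> r"
  using assms(2-)
proof (induction rule: finite_ne_induct)
  case (singleton x)
  then show ?case using lin by (auto simp: order_on_defs refl_on_def)
next
  case (insert x S)
  then obtain e where e: "e \<in> S" "\<forall>f\<in>S. (f, e) \<in> r" by auto
  have t: "trans r" "refl_on E r" using lin by (auto simp: order_on_defs)
  have xE: "x \<in> E" "e \<in> E" using insert e by auto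
  show ?case
  proof (rule linear_order_on_cases[OF lin xE])
    assume "(e, x) \<in> r"
    then have "\<forall>f\<in>insert x S. (f, x) \<in> r" using e t xE by (auto dest: transD refl_onD)
    then show ?thesis by blast
  qed (use e in auto)
qed

text \<open>Existence: going down, an unforced edge on which \<open>Q\<close> and \<open>H\<close>
  differ is switched by a member agreeing with \<open>Q\<close> above it. Uniqueness: at the
  greatest edge where two resolutions differ, each shows that the edge is unforced in the other, so
  both follow \<open>H\<close> there.\<close>

lemma exists_unique_resolution:
  assumes lin: "linear_order_on E r" and fin: "finite E" and sub: "\<Q> \<subseteq> Pow E" and ne: "\<Q> \<noteq> {}"
  shows "\<exists>!Q. Q \<in> \<Q> \<and> (\<forall>e\<in>E. forced r E \<Q> Q e \<or> (e \<in> Q \<longleftrightarrow> e \<in> H))"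
proof -
  let ?good = "\<lambda>Q e. forced r E \<Q> Q e \<or> (e \<in> Q \<longleftrightarrow> e \<in> H)"
  define n where "n e = card {g \<in> E. (g, e) \<in> r}" for e
  have n_less: "n e < n f" if "(e, f) \<in> r" "e \<noteq> f" for e f
    unfolding n_def by (rule linear_order_on_card_less[OF lin fin that])
  have n_le: "n e \<le> card E" for e unfolding n_def using fin by (simp add: card_mono)
  have tr: "trans r" using lin by (auto simp: order_on_defs)
  \<comment> \<open>The bound \<open>k\<close> descends from \<open>Suc (card E)\<close>, which
    exceeds every rank, to 0, where all edges are settled.\<close>
  have "\<exists>Q\<in>\<Q>. \<forall>e\<in>E. k \<le> n e \<longrightarrow> ?good Q e" if "k \<le> Suc (card E)" for k
    using that
  proof (induction rule: inc_induct)
    case base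
    have "\<not> Suc (card E) \<le> n e" for e using n_le[of e] by simp
    then show ?case using ne by blast
  next
    case (step k)
    then obtain Q where Q: "Q \<in> \<Q>" "\<And>e. e \<in> E \<Longrightarrow> Suc k \<le> n e \<Longrightarrow> ?good Q e" by blast
    show ?case
    proof (cases "\<exists>e\<in>E. n e = k \<and> \<not> ?good Q e")
      case False
      then have "\<forall>e\<in>E. k \<le> n e \<longrightarrow> ?good Q e" using Q(2) by (metis Suc_leI le_neq_implies_less)
      then show ?thesis using Q(1) by blast
    next
      case True
      then obtain e where e: "e \<in> E" "n e = k" "\<not> forced r E \<Q> Q e" "e \<in> Q \<longleftrightarrow> e \<notin> H" by blast
      then obtain Q' where Q': "Q' \<in> \<Q>" "\<And>f. f \<in> E \<Longrightarrow> (e, f) \<in> r \<Longrightarrow> f \<noteq> e \<Longrightarrow> f \<in> Q' \<longleftrightarrow> f \<in> Q"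
        "e \<in> Q' \<longleftrightarrow> e \<notin> Q" unfolding forced_def by blast
      have "?good Q' g" if g: "g \<in> E" "k \<le> n g" for g
      proof (rule linear_order_on_cases[OF lin e(1) g(1)])
        assume "e = g"
        then show ?thesis using e Q' by blast
      next
        assume "(g, e) \<in> r" "e \<noteq> g"
        then show ?thesis using n_less[of g e] e(2) g(2) by simp
      next
        assume eg: "(e, g) \<in> r" "e \<noteq> g" "(g, e) \<notin> r"
        have same: "g \<in> Q' \<longleftrightarrow> g \<in> Q" using Q'(2) g eg by blast
        \<comment> \<open>Being forced at \<open>g\<close> depends only on membership at and above
          \<open>g\<close>, where \<open>Q'\<close> agrees with \<open>Q\<close>.\<close>
        have "forced r E \<Q> Q' g" if f: "forced r E \<Q> Q g"
          unfolding forced_def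
        proof (intro ballI impI)
          fix Q'' assume Q'': "Q'' \<in> \<Q>"
            and agree: "\<forall>f\<in>E. (g, f) \<in> r \<and> f \<noteq> g \<longrightarrow> (f \<in> Q'' \<longleftrightarrow> f \<in> Q')"
          have "f \<in> Q'' \<longleftrightarrow> f \<in> Q" if "f \<in> E" "(g, f) \<in> r" "f \<noteq> g" for f
          proof -
            have "(e, f) \<in> r" "f \<noteq> e" using tr eg that by (auto dest: transD)
            then show ?thesis using agree Q'(2) that by blast
          qed
          then show "g \<in> Q'' \<longleftrightarrow> g \<in> Q'" using f Q'' same unfolding forced_def by blast
        qed
        moreover have "?good Q g" using Q(2)[OF g(1)] n_less[OF eg(1,2)] e(2) by simp
        ultimately show ?thesis using same by blast
      qed
      then show ?thesis using Q'(1) by blast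
    qed
  qed
  from this[of 0] obtain Q where Q: "Q \<in> \<Q>" "\<forall>e\<in>E. ?good Q e" by auto
  moreover have "Q1 = Q2" if "Q1 \<in> \<Q> \<and> (\<forall>e\<in>E. ?good Q1 e)" "Q2 \<in> \<Q> \<and> (\<forall>e\<in>E. ?good Q2 e)" for Q1 Q2
  proof (rule ccontr)
    assume "Q1 \<noteq> Q2"
    then have "sym_diff Q1 Q2 \<noteq> {}" by blast
    moreover have "sym_diff Q1 Q2 \<subseteq> E" using that sub by blast
    ultimately obtain e where e: "e \<in> sym_diff Q1 Q2" "\<forall>f\<in>sym_diff Q1 Q2. (f, e) \<in> r"
      using exists_greatest_linear_order_on[OF lin, of "sym_diff Q1 Q2"] fin finite_subset by metis
    have eE: "e \<in> E" using e(1) that sub by blast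
    have agree: "f \<in> Q1 \<longleftrightarrow> f \<in> Q2" if "f \<in> E" "(e, f) \<in> r" "f \<noteq> e" for f
      using linear_order_on_cases[OF lin eE that(1)] that e(2) by blast
    have "\<not> forced r E \<Q> Q1 e"
      unfolding forced_def using conjunct1[OF that(2)] e(1) agree by auto
    moreover have "\<not> forced r E \<Q> Q2 e"
      unfolding forced_def using conjunct1[OF that(1)] e(1) agree by auto
    ultimately have "e \<in> Q1 \<longleftrightarrow> e \<in> H" "e \<in> Q2 \<longleftrightarrow> e \<in> H" using that eE by auto
    then show False using e(1) by blast
  qed
  ultimately show ?thesis by (intro ex1I[of _ Q]) blast+
qed

section \<open>Activities\<close>

lemma one_vertex_partial_dual:
  assumes "ribbon_graph G" "Q \<in> quasi_trees G"
  shows "one_vertex (partial_dual G Q)"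
proof
  show "ribbon_graph (partial_dual G Q)" by (rule ribbon_graph_partial_dual[OF assms(1)])
  show "num_bc (partial_dual G Q) {} = 1"
    using num_bc_partial_dual[OF assms(1), of Q Q] assms(2) by (simp add: quasi_trees_def)
qed

lemma num_bc_sym_diff:
  assumes "ribbon_graph G" "Q \<subseteq> edges G" "W \<subseteq> edges G"
  shows "num_bc G (sym_diff Q W) = num_bc (partial_dual G Q) W"
proof -
  have "sym_diff (sym_diff Q W) Q = W" by blast
  moreover have "sym_diff Q W \<subseteq> edges G" using assms by blast
  ultimately show ?thesis using num_bc_partial_dual[OF assms(1), of "sym_diff Q W" Q] assms by simp
qed

abbreviation live_orientable :: "('e, 'd) ribbon_graph \<Rightarrow> 'e rel \<Rightarrow> 'e set \<Rightarrow> 'e set" where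
  "live_orientable G r Q \<equiv> {e \<in> edges G. live G r Q e \<and> orientable_edge G Q e}"

text \<open>Nothing in \<open>W\<close> is linked to \<open>e\<close>, since \<open>e\<close> is
  live and is the top of \<open>W\<close>.\<close>

lemma separated_live_orientable:
  assumes G: "ribbon_graph G" and Q: "Q \<in> quasi_trees G"
    and e: "e \<in> live_orientable G r Q" "e \<in> W" and W: "W \<subseteq> edges G" "\<forall>f\<in>W. (f, e) \<in> r"
  shows "num_bc (partial_dual G Q) (W - {e}) + 1 = num_bc (partial_dual G Q) W"
proof -
  interpret D: one_vertex "partial_dual G Q" by (rule one_vertex_partial_dual[OF assms(1,2)])
  have "\<not> alternate (partial_dual G Q) e f" if "f \<in> W - {e}" for f
    using that e W unfolding live_def links_def by blast
  moreover have "e \<in> edges (partial_dual G Q)" "orientable_loop (partial_dual G Q) e"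
    using e by (auto simp: orientable_edge_def)
  ultimately have "(Inl (e, False, False), Inl (e, True, True)) \<notin> (boundary_arcs (partial_dual G Q) W)\<^sup>*"
    using D.separated_if_not_alternate[of e W] e(2) by blast
  from num_bc_toggle_separated[OF ribbon_graph_partial_dual[OF G] _ _ this] e W show ?thesis
    by (simp add: toggle_def)
qed

text \<open>Edges are removed from the greatest down, because liveness excludes links only to lower
  edges. Each removal costs one boundary component.\<close>

lemma num_bc_live_orientable:
  assumes G: "ribbon_graph G" and Q: "Q \<in> quasi_trees G" and lin: "linear_order_on (edges G) r"
    and L: "L \<subseteq> live_orientable G r Q"
  shows "num_bc G (sym_diff Q L) = card L + 1"
proof -
  have "num_bc (partial_dual G Q) L = card L + 1"
    using L
  proof (induction "card L" arbitrary: L)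
    case 0
    have "finite L" using 0(2) by (rule finite_subset) (simp add: finite_edges[OF G])
    then have "L = {}" using 0 by simp
    then show ?case
      using one_vertex.one[OF one_vertex_partial_dual[OF G Q]] by simp
  next
    case (Suc n)
    then have fin: "finite L" "L \<noteq> {}" by (auto intro: card_ge_0_finite)
    have LE: "L \<subseteq> edges G" using Suc.prems by blast
    from exists_greatest_linear_order_on[OF lin fin LE] obtain e where e: "e \<in> L" "\<forall>f\<in>L. (f, e) \<in> r" by blast
    have card: "card L = Suc (card (L - {e}))" using card.remove[OF fin(1) e(1)] .
    have "num_bc (partial_dual G Q) (L - {e}) = card (L - {e}) + 1"
      by (rule Suc.hyps) (use Suc card in auto)
    moreover have "num_bc (partial_dual G Q) (L - {e}) + 1 = num_bc (partial_dual G Q) L"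
      by (rule separated_live_orientable[OF G Q _ e(1) LE e(2)]) (use e Suc.prems in blast)
    ultimately show ?case using card by simp
  qed
  then show ?thesis
    using num_bc_sym_diff[OF G, of Q L] Q L by (auto simp: quasi_trees_def)
qed

text \<open>If \<open>e\<close> is nonorientable or dead, \<open>{e}\<close> or
  \<open>{e, f}\<close> with a lower linked \<open>f\<close> toggles to a competing quasi-tree.
  Conversely, the difference \<open>W\<close> to a competitor has \<open>e\<close> on top, so
  toggling it leaves at least two boundary components.\<close>

lemma forced_iff_live_orientable:
  assumes G: "ribbon_graph G" and Q: "Q \<in> quasi_trees G" and lin: "linear_order_on (edges G) r"
    and e: "e \<in> edges G"
  shows "forced r (edges G) (quasi_trees G) Q e \<longleftrightarrow> live G r Q e \<and> orientable_edge G Q e"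
proof
  interpret D: one_vertex "partial_dual G Q" by (rule one_vertex_partial_dual[OF assms(1,2)])
  have QE: "Q \<subseteq> edges G" using Q by (simp add: quasi_trees_def)
  have quasi: "sym_diff Q W \<in> quasi_trees G \<longleftrightarrow> num_bc (partial_dual G Q) W = 1" if "W \<subseteq> edges G" for W
    using num_bc_sym_diff[OF G QE that] that QE by (auto simp: quasi_trees_def)
  have anti: "antisym r" using lin by (auto simp: order_on_defs)
  {
    assume forced: "forced r (edges G) (quasi_trees G) Q e"
    have no: False if W: "e \<in> W" "W \<subseteq> edges G" "num_bc (partial_dual G Q) W = 1" "\<forall>f\<in>W. (f, e) \<in> r \<or> f = e" for W
    proof -
      have "f \<in> sym_diff Q W \<longleftrightarrow> f \<in> Q" if "(e, f) \<in> r" "f \<noteq> e" for f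
        using W(4) that anti by (auto dest: antisymD)
      then have "e \<in> sym_diff Q W \<longleftrightarrow> e \<in> Q"
        using forced quasi[OF W(2)] W(3) unfolding forced_def by blast
      then show False using W(1) by blast
    qed
    have o: "orientable_loop (partial_dual G Q) e"
      using no[of "{e}"] D.num_bc_nonorientable[of e] e by auto
    moreover have "live G r Q e"
      unfolding live_def links_def
    proof
      assume "\<exists>f\<in>edges G. (f, e) \<in> r \<and> f \<noteq> e \<and> alternate (partial_dual G Q) e f"
      then obtain f where f: "f \<in> edges G" "(f, e) \<in> r" "f \<noteq> e" "alternate (partial_dual G Q) e f" by blast
      have "num_bc (partial_dual G Q) {e, f} = 1"
        by (rule D.num_bc_linked[OF _ _ f(3) o f(4)]) (use e f in simp_all)
      then show False using no[of "{e, f}"] e f by blast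
    qed
    ultimately show "live G r Q e \<and> orientable_edge G Q e" by (simp add: orientable_edge_def)
  }
  {
    assume lo: "live G r Q e \<and> orientable_edge G Q e"
    show "forced r (edges G) (quasi_trees G) Q e"
      unfolding forced_def
    proof (intro ballI impI, rule ccontr)
      fix Q' assume Q': "Q' \<in> quasi_trees G"
        and agree: "\<forall>f\<in>edges G. (e, f) \<in> r \<and> f \<noteq> e \<longrightarrow> (f \<in> Q') = (f \<in> Q)"
        and ne: "\<not> (e \<in> Q' \<longleftrightarrow> e \<in> Q)"
      define W where "W = sym_diff Q Q'"
      have WE: "W \<subseteq> edges G" using Q' QE by (auto simp: W_def quasi_trees_def)
      have "sym_diff Q W = Q'" unfolding W_def by blast
      then have 1: "num_bc (partial_dual G Q) W = 1" using quasi[OF WE] Q' by simp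
      have eW: "e \<in> W" using ne unfolding W_def by blast
      have below: "\<forall>f\<in>W. (f, e) \<in> r"
      proof
        fix f assume f: "f \<in> W"
        then have fE: "f \<in> edges G" using WE by blast
        show "(f, e) \<in> r"
        proof (rule linear_order_on_cases[OF lin fE e])
          assume "f = e"
          then show ?thesis using lin e by (auto simp: order_on_defs refl_on_def)
        next
          assume "(e, f) \<in> r" "f \<noteq> e"
          then show ?thesis using agree fE f unfolding W_def by blast
        qed
      qed
      have "num_bc (partial_dual G Q) (W - {e}) + 1 = num_bc (partial_dual G Q) W"
        by (rule separated_live_orientable[OF G Q _ eW WE below]) (use e lo in simp)
      moreover have "0 < num_bc (partial_dual G Q) (W - {e})"
        by (rule D.num_bc_pos) (use e WE in auto)
      ultimately show False using 1 by simp
    qed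
  }
qed

section \<open>The quasi-tree expansion\<close>

lemma quasi_tree_split:
  "Q = VI G r Q \<union> int_live_orientable G r Q" "VI G r Q \<inter> int_live_orientable G r Q = {}"
  "edges G - Q = VE G r Q \<union> ext_live_orientable G r Q" "VE G r Q \<inter> ext_live_orientable G r Q = {}"
  by (auto simp: VI_def VE_def int_live_orientable_def ext_live_orientable_def)

text \<open>The set is \<open>Q\<close> toggled in \<open>(?I - S) \<union> S'\<close>. Inserting an
  edge of \<open>S'\<close> raises the boundary count, whereas joining components would lower it, so
  \<open>S'\<close> does not affect the components. In \<open>s_param\<close> the term
  \<open>card S'\<close> cancels and \<open>card S\<close> counts twice.\<close>

lemma interval_of_quasi_tree:
  assumes G: "ribbon_graph G" and Q: "Q \<in> quasi_trees G" and lin: "linear_order_on (edges G) r"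
    and S: "S \<subseteq> int_live_orientable G r Q" and S': "S' \<subseteq> ext_live_orientable G r Q"
  shows "num_comp G (VI G r Q \<union> S \<union> S') = mcomp (quasi_tree_graph G r Q) S"
    and "s_param G (VI G r Q \<union> S \<union> S') =
      s_param G (VI G r Q) + 2 * nullity (quasi_tree_graph G r Q) S"
    and "0 \<le> nullity (quasi_tree_graph G r Q) S"
proof -
  let ?V = "VI G r Q" and ?I = "int_live_orientable G r Q" and ?X = "ext_live_orientable G r Q"
  have QE: "Q \<subseteq> edges G" using Q by (simp add: quasi_trees_def)
  have fin: "finite A" if "A \<subseteq> edges G" for A using that finite_edges[OF G] by (rule finite_subset)
  have sub: "?V \<subseteq> edges G" "?I \<subseteq> edges G" "?X \<subseteq> edges G" "?V \<subseteq> Q" "?I \<subseteq> Q" "?X \<inter> Q = {}"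
    using QE by (auto simp: VI_def int_live_orientable_def ext_live_orientable_def)
  have finI: "finite ?I" "finite S" "finite S'" "finite ?V" using sub S S' fin by auto
  \<comment> \<open>\<open>A\<close> and \<open>B\<close> are general because the count is also
    needed along the insertion of \<open>S'\<close> and for \<open>?V\<close> itself.\<close>
  have bc: "num_bc G (?V \<union> A \<union> B) + card A = card ?I + card B + 1" if A: "A \<subseteq> ?I" and B: "B \<subseteq> ?X" for A B
  proof -
    have "?V \<union> A \<union> B = sym_diff Q ((?I - A) \<union> B)"
      using quasi_tree_split(1,2)[where G = G and r = r and Q = Q] sub A B by blast
    moreover have "(?I - A) \<union> B \<subseteq> live_orientable G r Q"
      using B QE by (auto simp: int_live_orientable_def ext_live_orientable_def)
    ultimately have "num_bc G (?V \<union> A \<union> B) = card ((?I - A) \<union> B) + 1"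
      using num_bc_live_orientable[OF G Q lin] by simp
    also have "card ((?I - A) \<union> B) = card (?I - A) + card B"
      using A B sub finI fin by (intro card_Un_disjoint) auto
    also have "card (?I - A) = card ?I - card A"
      using A finI(1) by (simp add: card_Diff_subset finite_subset)
    finally show ?thesis using card_mono[OF finI(1) A] by simp
  qed
  have comp: "num_comp G (?V \<union> S \<union> S') = num_comp G (?V \<union> S)"
    using finI(3) S'
  proof (induction S')
    case (insert e B)
    let ?T = "?V \<union> S \<union> B"
    have e: "e \<in> edges G" "e \<notin> ?T" "?T \<subseteq> edges G" using insert sub S by auto
    have "num_bc G (insert e ?T) = num_bc G ?T + 1"
      using bc[OF S, of B] bc[OF S, of "insert e B"] insert by simp
    then have "num_comp G (insert e ?T) = num_comp G ?T"
      using num_bc_insert_of_num_comp_insert(2)[OF G e(3) e(1,2)] by linarith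
    then show ?case using insert by simp
  qed simp
  have mcomp: "mcomp (quasi_tree_graph G r Q) S = num_comp G (?V \<union> S)"
    unfolding quasi_tree_graph_def by (rule mcomp_component_graph[OF G]) (use S sub in blast)
  show "num_comp G (?V \<union> S \<union> S') = mcomp (quasi_tree_graph G r Q) S" using comp mcomp by simp
  have null: "nullity (quasi_tree_graph G r Q) S = int (card S) - int (num_comp G ?V) + int (num_comp G (?V \<union> S))"
    unfolding nullity_def mcomp by (simp add: quasi_tree_graph_def component_graph_def num_comp_def)
  then show "0 \<le> nullity (quasi_tree_graph G r Q) S"
    using num_comp_le_add_card[OF G finI(2) subset_trans[OF S sub(2)], of ?V] by simp
  have "card (?V \<union> S \<union> S') = card ?V + card S + card S'"
  proof -
    have "?V \<inter> S = {}" "(?V \<union> S) \<inter> S' = {}"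
      using quasi_tree_split(2)[where G = G and r = r and Q = Q] S S' sub by blast+
    then show ?thesis using finI by (simp add: card_Un_disjoint)
  qed
  then show "s_param G (?V \<union> S \<union> S') = s_param G ?V + 2 * nullity (quasi_tree_graph G r Q) S"
    using bc[OF S S'] bc[of "{}" "{}"] null comp by (simp add: s_param_def)
qed

section \<open>Passing to the dual\<close>

lemma dual_simps:
  assumes "Q \<subseteq> edges G"
  shows "edges (dual G) = edges G"
    "live (dual G) r (edges G - Q) = live G r Q"
    "orientable_edge (dual G) (edges G - Q) = orientable_edge G Q"
  using partial_dual_dual[OF assms]
  by (simp_all add: fun_eq_iff dual_def live_def links_def orientable_edge_def)

text \<open>Linking and orientability are unchanged, so only internal and external swap. Dual
  exponents then need no separate computation.\<close>

lemma dual_activities: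
  assumes "Q \<subseteq> edges G"
  shows "VI (dual G) r (edges G - Q) = VE G r Q"
    "int_live_orientable (dual G) r (edges G - Q) = ext_live_orientable G r Q"
    "ext_live_orientable (dual G) r (edges G - Q) = int_live_orientable G r Q"
    "quasi_tree_graph (dual G) r (edges G - Q) = dual_quasi_tree_graph G r Q"
  using assms
  by (auto simp: VI_def VE_def int_live_orientable_def ext_live_orientable_def
      quasi_tree_graph_def dual_quasi_tree_graph_def dual_simps)

text \<open>The dual is the partial dual by all edges, which sends \<open>Q\<close> to its
  complement and keeps the boundary count.\<close>

lemma dual_quasi_tree:
  assumes "ribbon_graph G" "Q \<in> quasi_trees G"
  shows "edges G - Q \<in> quasi_trees (dual G)"
proof -
  have Q: "Q \<subseteq> edges G" "num_bc G Q = 1" using assms by (auto simp: quasi_trees_def)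
  have "sym_diff Q (edges G) = edges G - Q" using Q by blast
  then have "num_bc (dual G) (edges G - Q) = 1"
    using num_bc_partial_dual[OF assms(1) Q(1) order.refl] Q(2) by (simp add: dual_def)
  then show ?thesis by (simp add: quasi_trees_def dual_def)
qed

text \<open>\<open>H\<close> may differ from \<open>Q\<close> only at live orientable edges, so the
  sets resolved to \<open>Q\<close> form a Boolean interval.\<close>

lemma resolution_iff:
  assumes G: "ribbon_graph G" and Q: "Q \<in> quasi_trees G" and lin: "linear_order_on (edges G) r"
    and H: "H \<subseteq> edges G"
  shows "(\<forall>e\<in>edges G. forced r (edges G) (quasi_trees G) Q e \<or> (e \<in> Q \<longleftrightarrow> e \<in> H)) \<longleftrightarrow>
    VI G r Q \<subseteq> H \<and> H \<inter> VE G r Q = {}"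
proof -
  have QE: "Q \<subseteq> edges G" using Q by (simp add: quasi_trees_def)
  have "(\<forall>e\<in>edges G. forced r (edges G) (quasi_trees G) Q e \<or> (e \<in> Q \<longleftrightarrow> e \<in> H)) \<longleftrightarrow>
    (\<forall>e\<in>edges G. live G r Q e \<and> orientable_edge G Q e \<or> (e \<in> Q \<longleftrightarrow> e \<in> H))"
    using forced_iff_live_orientable[OF G Q lin] by blast
  also have "\<dots> \<longleftrightarrow> VI G r Q \<subseteq> H \<and> H \<inter> VE G r Q = {}"
    using QE H by (auto simp: VI_def VE_def)
  finally show ?thesis .
qed

text \<open>
  The second coordinate is complemented, so that it is the edge set of the dual spanning subgraph.
\<close>

lemma bij_betw_intervals:
  assumes G: "ribbon_graph G" "connected_ribbon_graph G" and lin: "linear_order_on (edges G) r"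
  shows "bij_betw (\<lambda>(Q, S, S'). VI G r Q \<union> S \<union> (ext_live_orientable G r Q - S'))
    (SIGMA Q:quasi_trees G. Pow (int_live_orientable G r Q) \<times> Pow (ext_live_orientable G r Q))
    (Pow (edges G))"
    (is "bij_betw ?f ?D _")
proof -
  let ?I = "\<lambda>Q. int_live_orientable G r Q" and ?X = "\<lambda>Q. ext_live_orientable G r Q"
  let ?P = "\<lambda>H Q. Q \<in> quasi_trees G \<and> VI G r Q \<subseteq> H \<and> H \<inter> VE G r Q = {}"
  have ex1: "\<exists>!Q. ?P H Q" if "H \<subseteq> edges G" for H
  proof -
    have "\<exists>!Q. Q \<in> quasi_trees G \<and>
        (\<forall>e\<in>edges G. forced r (edges G) (quasi_trees G) Q e \<or> (e \<in> Q \<longleftrightarrow> e \<in> H))"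
      by (rule exists_unique_resolution[OF lin finite_edges[OF G(1)] _ exists_quasi_tree[OF G]])
         (auto simp: quasi_trees_def)
    then show ?thesis using resolution_iff[OF G(1) _ lin that] by (simp cong: conj_cong)
  qed
  have ex: "\<exists>Q. ?P H Q" if "H \<subseteq> edges G" for H
    using ex1_implies_ex[OF ex1[OF that]] .
  have unique: "Q = Q'" if "H \<subseteq> edges G" "?P H Q" "?P H Q'" for H Q Q'
    using the1_equality[OF ex1[OF that(1)] that(2)] the1_equality[OF ex1[OF that(1)] that(3)] by simp
  have QE: "Q \<subseteq> edges G" if "Q \<in> quasi_trees G" for Q using that by (simp add: quasi_trees_def)
  note split = quasi_tree_split[where G = G and r = r]
  have fE: "VI G r Q \<union> S \<union> (?X Q - S') \<subseteq> edges G" and fP: "?P (VI G r Q \<union> S \<union> (?X Q - S')) Q"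
    and fI: "(VI G r Q \<union> S \<union> (?X Q - S')) \<inter> ?I Q = S" and fX: "?X Q - (VI G r Q \<union> S \<union> (?X Q - S')) = S'"
    if "Q \<in> quasi_trees G" "S \<subseteq> ?I Q" "S' \<subseteq> ?X Q" for Q S S'
  proof -
    have "VI G r Q \<subseteq> Q" "?I Q \<subseteq> Q" "?X Q \<subseteq> edges G - Q" "VE G r Q \<subseteq> edges G - Q"
      using split[where Q = Q] by blast+
    note * = this QE[OF that(1)] split(2,4)[where Q = Q] that
    show "VI G r Q \<union> S \<union> (?X Q - S') \<subseteq> edges G" using * by blast
    show "?P (VI G r Q \<union> S \<union> (?X Q - S')) Q" using * by blast
    show "(VI G r Q \<union> S \<union> (?X Q - S')) \<inter> ?I Q = S" using * by blast
    show "?X Q - (VI G r Q \<union> S \<union> (?X Q - S')) = S'" using * by blast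
  qed
  show ?thesis
    unfolding bij_betw_def
  proof
    show "inj_on ?f ?D"
    proof (rule inj_onI, clarsimp)
      fix Q1 S1 S1' Q2 S2 S2'
      assume 1: "Q1 \<in> quasi_trees G" "S1 \<subseteq> ?I Q1" "S1' \<subseteq> ?X Q1"
        and 2: "Q2 \<in> quasi_trees G" "S2 \<subseteq> ?I Q2" "S2' \<subseteq> ?X Q2"
        and eq: "VI G r Q1 \<union> S1 \<union> (?X Q1 - S1') = VI G r Q2 \<union> S2 \<union> (?X Q2 - S2')"
      \<comment> \<open>The common set has a unique quasi-tree; its live orientable edges then
        recover the other two coordinates.\<close>
      have Q: "Q1 = Q2"
        using unique[OF fE[OF 1] fP[OF 1]] fP[OF 2] unfolding eq by blast
      moreover have "S1 = S2" using fI[OF 1] fI[OF 2] eq Q by metis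
      moreover have "S1' = S2'" using fX[OF 1] fX[OF 2] eq Q by metis
      ultimately show "Q1 = Q2 \<and> S1 = S2 \<and> S1' = S2'" by blast
    qed
    show "?f ` ?D = Pow (edges G)"
    proof (intro equalityI subsetI)
      fix H assume "H \<in> ?f ` ?D"
      then obtain Q S S' where "Q \<in> quasi_trees G" "S \<subseteq> ?I Q" "S' \<subseteq> ?X Q"
        and H: "H = VI G r Q \<union> S \<union> (?X Q - S')" by auto
      then show "H \<in> Pow (edges G)" using fE[of Q S S'] by simp
    next
      fix H assume "H \<in> Pow (edges G)"
      then have H: "H \<subseteq> edges G" by simp
      then obtain Q where Q: "?P H Q" using ex by blast
      have "H = VI G r Q \<union> (H \<inter> ?I Q) \<union> (?X Q - (?X Q - H))"
        using split[where Q = Q] H Q by blast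
      then have "H = ?f (Q, H \<inter> ?I Q, ?X Q - H)" by simp
      moreover have "(Q, H \<inter> ?I Q, ?X Q - H) \<in> ?D" using Q by auto
      ultimately show "H \<in> ?f ` ?D" by (rule image_eqI)
    qed
  qed
qed

theorem theorem4p4:
  fixes G :: "('e, 'd) ribbon_graph"
    and r :: "'e rel"
    and X Y A B a b :: "'k::comm_ring_1"
  assumes "ribbon_graph G"
    and "connected_ribbon_graph G"
    and "linear_order_on (edges G) r"
    and "a\<^sup>2 = A"
    and "b\<^sup>2 = B"
  shows "krushkal G X Y a b =
    (\<Sum>Q\<in>quasi_trees G.
       tutte (quasi_tree_graph G r Q) X A *
       tutte (dual_quasi_tree_graph G r Q) Y B *
       a ^ nat (s_param G (VI G r Q)) *
       b ^ nat (s_param (dual G) (VE G r Q)))"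
proof -
  let ?I = "\<lambda>Q. int_live_orientable G r Q" and ?X = "\<lambda>Q. ext_live_orientable G r Q"
  let ?K = "\<lambda>Q. quasi_tree_graph G r Q" and ?K' = "\<lambda>Q. dual_quasi_tree_graph G r Q"
  let ?term = "\<lambda>H. X ^ (num_comp G H - num_comp G (edges G)) *
        Y ^ (num_comp (dual G) (edges G - H) - num_comp (dual G) (edges G)) *
        a ^ nat (s_param G H) * b ^ nat (s_param (dual G) (edges G - H))"
  let ?t = "\<lambda>Q S. X ^ (mcomp (?K Q) S - mcomp (?K Q) (medges (?K Q))) * A ^ nat (nullity (?K Q) S)"
  let ?t' = "\<lambda>Q S. Y ^ (mcomp (?K' Q) S - mcomp (?K' Q) (medges (?K' Q))) * B ^ nat (nullity (?K' Q) S)"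
  let ?c = "\<lambda>Q. a ^ nat (s_param G (VI G r Q)) * b ^ nat (s_param (dual G) (VE G r Q))"
  note G = assms(1) and lin = assms(3)
  have G': "ribbon_graph (dual G)" unfolding dual_def by (rule ribbon_graph_partial_dual[OF G])
  have E': "edges (dual G) = edges G" by (simp add: dual_def)
  have fin: "finite (edges G)" by (rule finite_edges[OF G])
  \<comment> \<open>With \<open>x\<close> a square root, twice the nullity as exponent of
    \<open>x\<close> becomes the nullity as exponent of its square; the signs make
    \<open>nat\<close> additive.\<close>
  have power: "x ^ nat (s + 2 * n) = x ^ nat s * (x\<^sup>2) ^ nat n" if "0 \<le> s" "0 \<le> n" for x :: 'k and s n
    using that by (simp add: nat_add_distrib nat_mult_distrib power_add power_mult)
  have summand: "?term (VI G r Q \<union> S \<union> (?X Q - S')) = ?t Q S * ?t' Q S' * ?c Q"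
    if Q: "Q \<in> quasi_trees G" and S: "S \<subseteq> ?I Q" and S': "S' \<subseteq> ?X Q" for Q S S'
  proof -
    have QE: "Q \<subseteq> edges G" using Q by (simp add: quasi_trees_def)
    note Q' = dual_quasi_tree[OF G Q] and act = dual_activities[OF QE, where r = r]
    note split = quasi_tree_split[where G = G and r = r and Q = Q]
    note lin' = lin[folded E']
    let ?H = "VI G r Q \<union> S \<union> (?X Q - S')"
    \<comment> \<open>In the dual, \<open>S'\<close> enters the nullity and \<open>?I Q - S\<close>
      is the part that affects no exponent.\<close>
    have compl: "edges G - ?H = VE G r Q \<union> S' \<union> (?I Q - S)"
      using split QE S S' by blast
    have sub: "?X Q - S' \<subseteq> ?X Q" "?I Q - S \<subseteq> ?I Q" by auto
    note i = interval_of_quasi_tree[OF G Q lin S sub(1)]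
    note i' = interval_of_quasi_tree[OF G' Q' lin', unfolded act, OF S' sub(2)]
    have V: "VI G r Q \<subseteq> edges G" "VE G r Q \<subseteq> edges (dual G)"
      using split QE E' by blast+
    have Qsub: "Q \<subseteq> edges G" "edges G - Q \<subseteq> edges G" using QE by auto
    have one: "num_comp G (edges G) = 1" "num_comp (dual G) (edges G) = 1"
      by (rule num_comp_eq_1_if_quasi_tree[OF G Q Qsub(1)],
          rule num_comp_eq_1_if_quasi_tree[OF G' Q' Qsub(2)])
    have "mcomp (?K Q) (?I Q) = num_comp G Q"
      using interval_of_quasi_tree(1)[OF G Q lin subset_refl empty_subsetI] split(1) by simp
    then have m: "mcomp (?K Q) (medges (?K Q)) = 1"
      using num_comp_eq_1_if_quasi_tree[OF G Q subset_refl]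
      by (simp add: quasi_tree_graph_def component_graph_def)
    have "mcomp (?K' Q) (?X Q) = num_comp (dual G) (edges G - Q)"
      using interval_of_quasi_tree(1)[OF G' Q' lin', unfolded act, OF subset_refl empty_subsetI] split(3) by simp
    then have m': "mcomp (?K' Q) (medges (?K' Q)) = 1"
      using num_comp_eq_1_if_quasi_tree[OF G' Q' subset_refl]
      by (simp add: dual_quasi_tree_graph_def component_graph_def)
    have pa: "a ^ nat (s_param G ?H) = a ^ nat (s_param G (VI G r Q)) * A ^ nat (nullity (?K Q) S)"
      unfolding i(2) assms(4)[symmetric] by (rule power[OF s_param_nonneg[OF G V(1)] i(3)])
    have pb: "b ^ nat (s_param (dual G) (edges G - ?H)) =
        b ^ nat (s_param (dual G) (VE G r Q)) * B ^ nat (nullity (?K' Q) S')"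
      unfolding compl i'(2) assms(5)[symmetric] by (rule power[OF s_param_nonneg[OF G' V(2)] i'(3)])
    have "num_comp (dual G) (edges G - ?H) = mcomp (?K' Q) S'" unfolding compl by (rule i'(1))
    then show ?thesis unfolding pa pb i(1) one m m' by (simp add: mult_ac)
  qed
  \<comment> \<open>The bijection sorts the spanning subgraphs by quasi-tree; for each one,
    \<open>S\<close> and \<open>S'\<close> vary independently, so the inner sum factors into two
    Tutte polynomials.\<close>
  have "krushkal G X Y a b =
    (\<Sum>(Q, S, S')\<in>(SIGMA Q:quasi_trees G. Pow (?I Q) \<times> Pow (?X Q)). ?term (VI G r Q \<union> S \<union> (?X Q - S')))"
    unfolding krushkal_def sum.reindex_bij_betw[OF bij_betw_intervals[OF assms(1-3)], symmetric]
    by (rule sum.cong) auto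
  also have "\<dots> = (\<Sum>(Q, S, S')\<in>(SIGMA Q:quasi_trees G. Pow (?I Q) \<times> Pow (?X Q)). ?t Q S * ?t' Q S' * ?c Q)"
    using summand by (intro sum.cong) auto
  also have "\<dots> = (\<Sum>Q\<in>quasi_trees G. \<Sum>(S, S')\<in>Pow (?I Q) \<times> Pow (?X Q). ?t Q S * ?t' Q S' * ?c Q)"
  proof (rule sum.Sigma[symmetric])
    show "finite (quasi_trees G)"
      by (rule finite_subset[of _ "Pow (edges G)"]) (use fin in \<open>auto simp: quasi_trees_def\<close>)
    show "\<forall>Q\<in>quasi_trees G. finite (Pow (?I Q) \<times> Pow (?X Q))"
    proof
      fix Q assume "Q \<in> quasi_trees G"
      then have "?I Q \<subseteq> edges G" "?X Q \<subseteq> edges G"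
        by (auto simp: quasi_trees_def int_live_orientable_def ext_live_orientable_def)
      then have "finite (?I Q)" "finite (?X Q)" using fin finite_subset by blast+
      then show "finite (Pow (?I Q) \<times> Pow (?X Q))" by simp
    qed
  qed
  also have "\<dots> = (\<Sum>Q\<in>quasi_trees G. tutte (?K Q) X A * tutte (?K' Q) Y B * ?c Q)"
  proof (rule sum.cong[OF refl])
    fix Q
    have "(\<Sum>(S, S')\<in>Pow (?I Q) \<times> Pow (?X Q). ?t Q S * ?t' Q S' * ?c Q) =
      (\<Sum>S\<in>Pow (?I Q). ?t Q S) * (\<Sum>S'\<in>Pow (?X Q). ?t' Q S') * ?c Q"
      by (simp only: sum_product sum.cartesian_product) (simp add: sum_distrib_right case_prod_unfold)
    moreover have "medges (?K Q) = ?I Q" "medges (?K' Q) = ?X Q"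
      by (simp_all add: quasi_tree_graph_def dual_quasi_tree_graph_def component_graph_def)
    ultimately show "(\<Sum>(S, S')\<in>Pow (?I Q) \<times> Pow (?X Q). ?t Q S * ?t' Q S' * ?c Q) =
      tutte (?K Q) X A * tutte (?K' Q) Y B * ?c Q"
      by (simp add: tutte_def)
  qed
  finally show ?thesis by (simp add: mult.assoc)
qed

end
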